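(* There exists a universal constant $L>0$ such that the following holds. Let $N$ be a positive integer, let $\mathbb{T}$ be a Polish space, let $\nu$ be a Borel probability measure on $\mathbb{T}$, and let $Y_1,\ldots,Y_N$ be i.i.d. random variables with distribution $\nu$. Let $\mathcal{F}$ be a finite collection of Borel functions $f:\mathbb{T}\to\mathbb{R}_{\ge 0}$ with $\mathcal{F}\subseteq L^\infty(\mathbb{T})$. For a nonnegative Borel function $f$ on $\mathbb{T}$ write $Z_f=\frac1N\sum_{i=1}^N f(Y_i)$. Assume that $0<\mathbb{E}[\sup_{f\in\mathcal{F}}Z_f]<\infty$. Then one can find a collection $\mathcal{C}$ of pairs $(g,t)$, where $g$ is a nonnegative Borel function on $\mathbb{T}$ and $t>0$, such that, with $E_{g,t}:=\{Z_g\ge t\}$, $$\left\{\sup_{f\in\mathcal{F}}Z_f\ \ge\ L\,\mathbb{E}\sup_{f\in\mathcal{F}}Z_f\right\}\subset\bigcup_{(g,t)\in\mathcal{C}}E_{g,t}$$ and $$\sum_{(g,t)\in\mathcal{C}}\mathbb{P}(E_{g,t})\le\frac12.$$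
   Context: $L^\infty(\mathbb{T})$ denotes bounded functions on $\mathbb{T}$. *)

theory Defs
  imports "HOL-Probability.Probability"
begin

definition iid_sample ::
  "'w measure \<Rightarrow> 'a::polish_space measure \<Rightarrow> nat \<Rightarrow> (nat \<Rightarrow> 'w \<Rightarrow> 'a) \<Rightarrow> bool" where
  "iid_sample M \<nu> N Y \<longleftrightarrow>
     prob_space.indep_vars M (\<lambda>_. borel) Y {1..N} \<and> (\<forall>i\<in>{1..N}. distr M borel (Y i) = \<nu>)"

definition nonneg_borel :: "('a::polish_space \<Rightarrow> real) set" where
  "nonneg_borel = {f \<in> borel_measurable borel. \<forall>x. 0 \<le> f x}"

definition emp_mean :: "nat \<Rightarrow> (nat \<Rightarrow> 'w \<Rightarrow> 'a) \<Rightarrow> ('a \<Rightarrow> real) \<Rightarrow> 'w \<Rightarrow> real" where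
  "emp_mean N Y f \<omega> = (1 / real N) * (\<Sum>i=1..N. f (Y i \<omega>))"

(* Valued in [0, \<infinity>], so that the expectation below is a Lebesgue integral with no integrability
   side condition, and the supremum over the empty family is 0. *)
definition emp_sup :: "nat \<Rightarrow> (nat \<Rightarrow> 'w \<Rightarrow> 'a) \<Rightarrow> ('a \<Rightarrow> real) set \<Rightarrow> 'w \<Rightarrow> ennreal" where
  "emp_sup N Y F \<omega> = (SUP f\<in>F. ennreal (emp_mean N Y f \<omega>))"

definition expected_sup ::
  "'w measure \<Rightarrow> nat \<Rightarrow> (nat \<Rightarrow> 'w \<Rightarrow> 'a) \<Rightarrow> ('a \<Rightarrow> real) set \<Rightarrow> ennreal" where
  "expected_sup M N Y F = (\<integral>\<^sup>+ \<omega>. emp_sup N Y F \<omega> \<partial>M)"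

definition half_space ::
  "'w measure \<Rightarrow> nat \<Rightarrow> (nat \<Rightarrow> 'w \<Rightarrow> 'a) \<Rightarrow> ('a \<Rightarrow> real) \<Rightarrow> real \<Rightarrow> 'w set" where
  "half_space M N Y g t = {\<omega> \<in> space M. t \<le> emp_mean N Y g \<omega>}"

(* The collection C has to be countable.  Otherwise, for an atomless law, the uncountably many null
   events {Y_i = x for some i}, one for each point x, would cover the whole probability space at
   total cost 0.  The sum is taken in [0, \<infinity>], so that divergence is not read as 0. *)
definition small_cover ::
  "real \<Rightarrow> 'w measure \<Rightarrow> nat \<Rightarrow> (nat \<Rightarrow> 'w \<Rightarrow> 'a::polish_space) \<Rightarrow> ('a \<Rightarrow> real) set
     \<Rightarrow> (('a \<Rightarrow> real) \<times> real) set \<Rightarrow> bool" where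
  "small_cover L M N Y F C \<longleftrightarrow>
     countable C \<and> C \<subseteq> nonneg_borel \<times> {0<..} \<and>
     {\<omega> \<in> space M. ennreal L * expected_sup M N Y F \<le> emp_sup N Y F \<omega>}
        \<subseteq> (\<Union>(g, t)\<in>C. half_space M N Y g t) \<and>
     (\<Sum>\<^sub>\<infinity>(g, t)\<in>C. emeasure M (half_space M N Y g t)) \<le> 1 / 2"

definition admissible_constant :: "'a::polish_space itself \<Rightarrow> 'w itself \<Rightarrow> real \<Rightarrow> bool" where
  "admissible_constant TA TW L \<longleftrightarrow>
     (\<forall>(N :: nat) (\<nu> :: 'a measure) (M :: 'w measure) (Y :: nat \<Rightarrow> 'w \<Rightarrow> 'a) (F :: ('a \<Rightarrow> real) set).
        0 < N \<longrightarrow>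
        prob_space \<nu> \<longrightarrow> sets \<nu> = sets borel \<longrightarrow>
        prob_space M \<longrightarrow> iid_sample M \<nu> N Y \<longrightarrow>
        finite F \<longrightarrow> F \<subseteq> nonneg_borel \<longrightarrow> (\<forall>f\<in>F. bounded (range f)) \<longrightarrow>
        0 < expected_sup M N Y F \<longrightarrow> expected_sup M N Y F < \<infinity> \<longrightarrow>
        (\<exists>C. small_cover L M N Y F C))"

(* In "EX L. admissible_constant TYPE('a) TYPE('w) L" the witness could depend on the types of the
   Polish space and of the sample space, because HOL cannot quantify over types under the
   existential.  A universal constant is therefore a closed term: a positive constant chosen once,
   at one pair of types (the Polish space R^\<nat> and sample space (R^\<nat>)^\<nat>), which is
   then to serve for every Polish space and every sample space. *)
definition universal_constant :: real where
  "universal_constant =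
     (SOME L. 0 < L \<and> admissible_constant TYPE(nat \<Rightarrow> real) TYPE(nat \<Rightarrow> nat \<Rightarrow> real) L)"

end

(* The witnessing constant is 801, and the covering half-spaces are found by a minimum-fragment
   argument. After discretisation and rescaling, the law p lives on a countable type, Lambda is a
   family of nonnegative weights and the event to cover is "some l in Lambda has total weight at
   least 1 on the sample y". Draw an independent sample w of size 200 N. With probability at least
   1/2, no l has mass 1/2 on w. Inside each y of the event choose an inclusion-minimal U such that
   w + U is still good at size u = |U|. Then U is nonempty and minimality forces it into the points
   of w + U above a level s that depends only on w + U and u. There are at most 2 u such points, so
   w + U admits at most 4^u fragments of size u. By exchangeability, the probability that u further
   points form a fragment for w is therefore at most 4^u / binomial(200 N + u, u), so the expected
   number of fragments of size u inside a sample of size N is at most (4/200)^u. Passing from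
   "y contains U" to a half-space by an exponential Chernoff bound costs a factor exp(2 u), and
   the geometric series stays below 1/4. So some w has both properties. *)

theory Submission
  imports Defs "HOL-Combinatorics.Multiset_Permutations"
begin

section \<open>Fragments\<close>

text \<open>At the best \<open>s\<close>, the number \<open>\<Sum>x\<in>#Z. min (l x) s\<close> minus \<open>2 * t * s\<close> is the \<open>l\<close>-mass of
  \<open>Z\<close> outside its \<open>2 * t\<close> heaviest points, by linear programming duality. So \<open>Z\<close> is good at size
  \<open>t\<close> if some \<open>l\<close> gives it mass at least 1, the mass outside these points being counted twice.\<close>

definition good :: "('x \<Rightarrow> real) set \<Rightarrow> 'x multiset \<Rightarrow> nat \<Rightarrow> bool" where
  "good \<Lambda> Z t \<longleftrightarrow> (\<exists>l\<in>\<Lambda>. \<exists>s\<ge>0. 1 + 2 * real t * s \<le> (\<Sum>x\<in>#Z. l x + min (l x) s))"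

text \<open>The size parameter shrinks with \<open>V\<close>: removing a point from \<open>U\<close>
  also relaxes the inequality in \<open>good\<close>, and this is what makes light points
  removable.\<close>

definition fragment :: "('x \<Rightarrow> real) set \<Rightarrow> 'x multiset \<Rightarrow> 'x multiset \<Rightarrow> bool" where
  "fragment \<Lambda> W U \<longleftrightarrow>
     good \<Lambda> (W + U) (size U) \<and> (\<forall>V. V \<subset># U \<longrightarrow> \<not> good \<Lambda> (W + V) (size V))"

section \<open>Optimising the level of a good multiset\<close>

lemma sum_mset_min_raise:
  fixes l :: "'x \<Rightarrow> real"
  assumes "s \<le> s'" "\<And>x. x \<in># Z \<Longrightarrow> s < l x \<Longrightarrow> s' \<le> l x"
  shows "(\<Sum>x\<in>#Z. l x + min (l x) s') =
         (\<Sum>x\<in>#Z. l x + min (l x) s) + (s' - s) * real (size {#x \<in># Z. s < l x#})"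
  using assms(2)
proof (induction Z)
  case (add y Z)
  have "l y + min (l y) s' = l y + min (l y) s + (if s < l y then s' - s else 0)"
    using add.prems[of y] assms(1) by (auto simp: min_def)
  with add show ?case by (simp add: algebra_simps)
qed auto

text \<open>As a function of \<open>s\<close>, the right side minus \<open>2 * real t * s\<close> is
  piecewise linear and concave, with slope the number of points above \<open>s\<close> minus
  \<open>2 * t\<close>. While this slope is positive, \<open>s\<close> can move up to the next value
  of \<open>l\<close>; fewer points then remain above it, so the process ends.\<close>

lemma raise_level:
  fixes l :: "'x \<Rightarrow> real"
  assumes "0 \<le> s" "1 + 2 * real t * s \<le> (\<Sum>x\<in>#Z. l x + min (l x) s)"
  shows "\<exists>s'\<ge>0. 1 + 2 * real t * s' \<le> (\<Sum>x\<in>#Z. l x + min (l x) s') \<and>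
                 size {#x \<in># Z. s' < l x#} \<le> 2 * t"
  using assms
proof (induction "size {#x \<in># Z. s < l x#}" arbitrary: s rule: less_induct)
  case less
  define A where "A = {#x \<in># Z. s < l x#}"
  show ?case
  proof (cases "size A \<le> 2 * t")
    case True
    then show ?thesis using less.prems A_def by blast
  next
    case False
    then have ne: "set_mset A \<noteq> {}" by auto
    define s' where "s' = Min (l ` set_mset A)"
    have "s' \<in> l ` set_mset A" unfolding s'_def using ne by (intro Min_in) auto
    then obtain a where a: "a \<in># A" "s' = l a" by auto
    have s': "s < s'" using a by (auto simp: A_def)
    have le: "s' \<le> l x" if "x \<in># Z" "s < l x" for x
      unfolding s'_def using that by (intro Min_le) (auto simp: A_def)
    \<comment> \<open>More than \<open>2 * t\<close> points gain \<open>s' - s\<close> each, which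
      pays for the growth of the left side.\<close>
    have "(s' - s) * (2 * real t) \<le> (s' - s) * real (size A)"
      using False s' by (intro mult_left_mono) auto
    then have "1 + 2 * real t * s' \<le> (\<Sum>x\<in>#Z. l x + min (l x) s')"
      using sum_mset_min_raise[of s s' Z l] le s' less.prems(2)
      unfolding A_def[symmetric] by (simp add: algebra_simps)
    moreover have "{#x \<in># Z. s' < l x#} \<subset># A"
    proof -
      have "{#x \<in># Z. s' < l x#} = filter_mset (\<lambda>x. s' < l x) A"
        unfolding A_def filter_filter_mset using s' by (intro filter_mset_cong) auto
      moreover have "a \<notin># filter_mset (\<lambda>x. s' < l x) A" using a by auto
      ultimately show ?thesis using a(1)
        by (metis multiset_filter_subset subset_mset.le_neq_trans)
    qed
    ultimately show ?thesis
      using less.hyps[of s'] less.prems s' mset_subset_size A_def by fastforce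
  qed
qed

text \<open>Dropping a point at or below the level \<open>s\<close> costs the left-hand side of the inequality at most
  \<open>2 * s\<close>, which is what the right-hand side gains. This would contradict minimality.\<close>

lemma fragment_above_level:
  assumes "fragment \<Lambda> W U" "l \<in> \<Lambda>" "0 \<le> s"
    and ineq: "1 + 2 * real (size U) * s \<le> (\<Sum>x\<in>#W + U. l x + min (l x) s)"
    and x: "x \<in># U"
  shows "s < l x"
proof (rule ccontr)
  assume "\<not> s < l x"
  obtain V where V: "U = add_mset x V" using x by (metis insert_DiffM)
  have "good \<Lambda> (W + V) (size V)"
    unfolding good_def
    using ineq assms(2,3) \<open>\<not> s < l x\<close>
    by (intro bexI[of _ l] exI[of _ s]) (auto simp: V algebra_simps min_def split: if_splits)
  moreover have "V \<subset># U" by (simp add: V)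
  ultimately show False using assms(1) by (auto simp: fragment_def)
qed

section \<open>Random splittings and exchangeability\<close>

text \<open>The sum of \<open>h\<close> over all \<open>2 ^ n\<close> ways to distribute the positions of a list of length \<open>n\<close>
  over two multisets.\<close>

primrec split_sum :: "'x list \<Rightarrow> ('x multiset \<Rightarrow> 'x multiset \<Rightarrow> ennreal) \<Rightarrow> ennreal" where
  "split_sum [] h = h {#} {#}"
| "split_sum (x # xs) h =
     split_sum xs (\<lambda>W U. h W (add_mset x U)) + split_sum xs (\<lambda>W U. h (add_mset x W) U)"

text \<open>A point violating \<open>Q\<close> has to go to \<open>W\<close>, and every other point
  has two places. So at most \<open>2 ^ k\<close> terms are nonzero, where \<open>k\<close> counts
  the positions satisfying \<open>Q\<close>.\<close>

lemma split_sum_le_power: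
  assumes "\<And>W U. W + U = mset xs \<Longrightarrow> h W U \<le> of_bool (\<forall>x\<in>#U. Q x)"
  shows "split_sum xs h \<le> 2 ^ size (filter_mset Q (mset xs))"
  using assms
proof (induction xs arbitrary: h)
  case Nil
  then show ?case using Nil[of "{#}" "{#}"] by simp
next
  case (Cons x xs)
  have 2: "split_sum xs (\<lambda>W U. h (add_mset x W) U) \<le> 2 ^ size (filter_mset Q (mset xs))"
    using Cons.prems by (intro Cons.IH) auto
  show ?case
  proof (cases "Q x")
    case True
    have "split_sum xs (\<lambda>W U. h W (add_mset x U)) \<le> 2 ^ size (filter_mset Q (mset xs))"
    proof (rule Cons.IH)
      fix W U assume "W + U = mset xs"
      then show "h W (add_mset x U) \<le> of_bool (\<forall>x\<in>#U. Q x)"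
        using Cons.prems[of W "add_mset x U"] True by simp
    qed
    from add_mono[OF this 2] show ?thesis using True by (simp add: mult_2)
  next
    case False
    have "split_sum ys h' = 0" if "\<And>W U. W + U = mset ys \<Longrightarrow> h' W U = 0"
      for ys :: "'a list" and h'
      using that by (induction ys arbitrary: h') auto
    moreover have "h W (add_mset x U) = 0" if "W + U = mset xs" for W U
      using Cons.prems[of W "add_mset x U"] that False by simp
    ultimately have "split_sum xs (\<lambda>W U. h W (add_mset x U)) = 0" by simp
    with 2 show ?thesis using False by simp
  qed
qed

lemma nn_integral_replicate_pmf_Suc:
  "(\<integral>\<^sup>+z. f z \<partial>replicate_pmf (Suc n) p) = (\<integral>\<^sup>+x. \<integral>\<^sup>+z. f (x # z) \<partial>replicate_pmf n p \<partial>p)"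
  by simp

text \<open>Tonelli's theorem, obtained from the commutativity of \<open>bind_pmf\<close>.\<close>

lemma nn_integral_pmf_swap:
  fixes f :: "'x \<Rightarrow> 'y \<Rightarrow> ennreal"
  shows "(\<integral>\<^sup>+x. \<integral>\<^sup>+y. f x y \<partial>measure_pmf q \<partial>measure_pmf p) =
         (\<integral>\<^sup>+y. \<integral>\<^sup>+x. f x y \<partial>measure_pmf p \<partial>measure_pmf q)"
proof -
  have "(\<integral>\<^sup>+z. f (fst z) (snd z) \<partial>bind_pmf p (\<lambda>x. bind_pmf q (\<lambda>y. return_pmf (x, y)))) =
        (\<integral>\<^sup>+z. f (fst z) (snd z) \<partial>bind_pmf q (\<lambda>y. bind_pmf p (\<lambda>x. return_pmf (x, y))))"
    by (subst bind_commute_pmf) simp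
  then show ?thesis by simp
qed

text \<open>Any \<open>u\<close> positions of an i.i.d. sample and the remaining
  \<open>n - u\<close> carry independent samples, so all \<open>n choose u\<close> splittings have
  the same mean. The induction follows Pascal's rule, according to where the first point
  goes.\<close>

lemma nn_integral_split_sum:
  fixes p :: "'x pmf"
  shows "(\<integral>\<^sup>+z. split_sum z (\<lambda>W U. if size U = u then h W U else 0) \<partial>replicate_pmf n p) =
   of_nat (n choose u) *
   (\<integral>\<^sup>+w. \<integral>\<^sup>+v. h (mset w) (mset v) \<partial>replicate_pmf u p \<partial>replicate_pmf (n - u) p)"
proof (induction n arbitrary: u h)
  case 0
  then show ?case by (cases u) auto
next
  case (Suc n)
  have step: "(\<integral>\<^sup>+z. split_sum z (\<lambda>W U. if size U = u then h W U else 0) \<partial>replicate_pmf (Suc n) p) =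
     (\<integral>\<^sup>+x. (\<integral>\<^sup>+z. split_sum z (\<lambda>W U. if Suc (size U) = u then h W (add_mset x U) else 0) \<partial>replicate_pmf n p) \<partial>p) +
     (\<integral>\<^sup>+x. (\<integral>\<^sup>+z. split_sum z (\<lambda>W U. if size U = u then h (add_mset x W) U else 0) \<partial>replicate_pmf n p) \<partial>p)"
    unfolding nn_integral_replicate_pmf_Suc by (simp add: nn_integral_add)
  show ?case
  proof (cases u)
    case 0
    have zero: "split_sum z (\<lambda>W U. 0) = 0" for z :: "'x list" by (induction z) auto
    have "(\<integral>\<^sup>+z. split_sum z (\<lambda>W U. if size U = 0 then h (add_mset x W) U else 0) \<partial>replicate_pmf n p)
       = (\<integral>\<^sup>+w. h (mset (x # w)) {#} \<partial>replicate_pmf n p)" for x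
      using Suc.IH[of 0 "\<lambda>W U. h (add_mset x W) U"] by simp
    then show ?thesis unfolding step 0 by (simp add: zero del: size_eq_0_iff_empty)
  next
    case (Suc v)
    have IH1: "(\<integral>\<^sup>+z. split_sum z (\<lambda>W U. if Suc (size U) = u then h W (add_mset x U) else 0) \<partial>replicate_pmf n p)
       = of_nat (n choose v) * (\<integral>\<^sup>+w. \<integral>\<^sup>+v. h (mset w) (mset (x # v)) \<partial>replicate_pmf v p \<partial>replicate_pmf (n - v) p)" for x
      using Suc.IH[of v "\<lambda>W U. h W (add_mset x U)"] by (simp add: Suc)
    have IH2: "(\<integral>\<^sup>+z. split_sum z (\<lambda>W U. if size U = u then h (add_mset x W) U else 0) \<partial>replicate_pmf n p)
       = of_nat (n choose u) * (\<integral>\<^sup>+w. \<integral>\<^sup>+v. h (mset (x # w)) (mset v) \<partial>replicate_pmf u p \<partial>replicate_pmf (n - u) p)" for x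
      using Suc.IH[of u "\<lambda>W U. h (add_mset x W) U"] by simp
    let ?J = "\<integral>\<^sup>+w. \<integral>\<^sup>+v. h (mset w) (mset v) \<partial>replicate_pmf u p \<partial>replicate_pmf (Suc n - u) p"
    \<comment> \<open>The first point is drawn outside both integrals; moving it past
      \<open>w\<close> makes it the head of the sample of size \<open>u\<close>.\<close>
    have "(\<integral>\<^sup>+x. \<integral>\<^sup>+w. \<integral>\<^sup>+v. h (mset w) (mset (x # v)) \<partial>replicate_pmf v p \<partial>replicate_pmf (n - v) p \<partial>p) = ?J"
      unfolding Suc diff_Suc_Suc nn_integral_replicate_pmf_Suc by (rule nn_integral_pmf_swap)
    then have 1: "(\<integral>\<^sup>+x. (\<integral>\<^sup>+z. split_sum z (\<lambda>W U. if Suc (size U) = u then h W (add_mset x U) else 0) \<partial>replicate_pmf n p) \<partial>p)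
       = of_nat (n choose v) * ?J"
      unfolding IH1 by (subst nn_integral_cmult) auto
    have 2: "(\<integral>\<^sup>+x. (\<integral>\<^sup>+z. split_sum z (\<lambda>W U. if size U = u then h (add_mset x W) U else 0) \<partial>replicate_pmf n p) \<partial>p)
       = of_nat (n choose u) * ?J"
    \<comment> \<open>Subtraction is truncated: \<open>Suc n - u\<close> equals
      \<open>Suc (n - u)\<close> only for \<open>u \<le> n\<close>. Otherwise
      \<open>n choose u\<close> is \<open>0\<close>.\<close>
    proof (cases "u \<le> n")
      case True
      then have "Suc n - u = Suc (n - u)" by simp
      then have "?J = (\<integral>\<^sup>+x. \<integral>\<^sup>+w. \<integral>\<^sup>+v. h (mset (x # w)) (mset v) \<partial>replicate_pmf u p \<partial>replicate_pmf (n - u) p \<partial>p)"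
        by (simp only: nn_integral_replicate_pmf_Suc)
      then show ?thesis unfolding IH2 by (subst nn_integral_cmult) auto
    next
      case False
      then show ?thesis unfolding IH2 by (simp add: binomial_eq_0)
    qed
    show ?thesis unfolding step 1 2 using Suc by (simp add: distrib_right)
  qed
qed

text \<open>One pair \<open>l\<close>, \<open>s\<close>, chosen from the union \<open>z\<close> of
  both samples alone, serves all splittings of \<open>z\<close>, and at most \<open>2 * u\<close>
  points of \<open>z\<close> lie above \<open>s\<close>. Every fragment of size \<open>u\<close>
  consists of such points, which leaves at most \<open>2 ^ (2 * u)\<close> splittings. Averaging
  over \<open>z\<close> gives the binomial factor.\<close>

lemma fragment_probability:
  fixes \<Lambda> :: "('x \<Rightarrow> real) set" and p :: "'x pmf"
  shows "of_nat (m + u choose u) *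
   (\<integral>\<^sup>+w. \<integral>\<^sup>+v. of_bool (fragment \<Lambda> (mset w) (mset v)) \<partial>replicate_pmf u p \<partial>replicate_pmf m p)
   \<le> 4 ^ u"
proof -
  have bound: "split_sum z (\<lambda>W U. if size U = u then of_bool (fragment \<Lambda> W U) else 0) \<le> 4 ^ u"
    for z :: "'x list"
  proof (cases "good \<Lambda> (mset z) u")
    case True
    then obtain l s0 where l: "l \<in> \<Lambda>" and s0: "s0 \<ge> 0"
      "1 + 2 * real u * s0 \<le> (\<Sum>x\<in>#mset z. l x + min (l x) s0)"
      unfolding good_def by blast
    obtain s where s: "s \<ge> 0" "1 + 2 * real u * s \<le> (\<Sum>x\<in>#mset z. l x + min (l x) s)"
      "size {#x \<in># mset z. s < l x#} \<le> 2 * u"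
      using raise_level[OF s0] by blast
    have "split_sum z (\<lambda>W U. if size U = u then of_bool (fragment \<Lambda> W U) else 0)
          \<le> 2 ^ size {#x \<in># mset z. s < l x#}"
      proof (rule split_sum_le_power)
      fix W U assume WU: "W + U = mset z"
      then show "(if size U = u then of_bool (fragment \<Lambda> W U) else 0) \<le> (of_bool (\<forall>x\<in>#U. s < l x) :: ennreal)"
        using fragment_above_level[of \<Lambda> W U l s] l s by auto
    qed
    also have "\<dots> \<le> 2 ^ (2 * u)" using s(3) by (intro power_increasing) auto
    finally show ?thesis by (simp add: power_mult)
  next
    case False
    \<comment> \<open>The constant predicate \<open>False\<close> is allowed here, because no
      splitting of such a \<open>z\<close> yields a fragment of size \<open>u\<close>.\<close>
    have "split_sum z (\<lambda>W U. if size U = u then of_bool (fragment \<Lambda> W U) else 0)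
          \<le> 2 ^ size {#x \<in># mset z. False#}"
      by (rule split_sum_le_power) (use False in \<open>auto simp: fragment_def\<close>)
    also have "\<dots> \<le> 4 ^ u" by simp
    finally show ?thesis .
  qed
  have "of_nat (m + u choose u) *
      (\<integral>\<^sup>+w. \<integral>\<^sup>+v. of_bool (fragment \<Lambda> (mset w) (mset v)) \<partial>replicate_pmf u p \<partial>replicate_pmf m p)
    = (\<integral>\<^sup>+z. split_sum z (\<lambda>W U. if size U = u then of_bool (fragment \<Lambda> W U) else 0) \<partial>replicate_pmf (m + u) p)"
    by (subst nn_integral_split_sum) simp
  also have "\<dots> \<le> (\<integral>\<^sup>+z. 4 ^ u \<partial>replicate_pmf (m + u) p)"
    by (intro nn_integral_mono bound)
  finally show ?thesis by simp
qed

section \<open>The cost of the fragments\<close>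

text \<open>Apart from the factor \<open>exp (2 * size U)\<close>, which is the loss in passing to half-spaces, this is
  the expected number of index sets along which a sample of size \<open>N\<close> shows exactly \<open>U\<close>.\<close>

definition cost :: "nat \<Rightarrow> 'x pmf \<Rightarrow> 'x multiset \<Rightarrow> real" where
  "cost N p U = exp (2 * real (size U)) * real (N choose size U) *
                pmf (map_pmf mset (replicate_pmf (size U) p)) U"

text \<open>Sorting by size turns a sum over multisets into probabilities for samples of length
  \<open>u\<close>; these are what \<open>fragment_probability\<close> controls once
  \<open>W\<close> is averaged.\<close>

lemma fragment_total_cost:
  fixes p :: "'x pmf"
  shows "(\<integral>\<^sup>+U. ennreal (cost N p U) * of_bool (fragment \<Lambda> W U \<and> 1 \<le> size U \<and> size U \<le> N) \<partial>count_space UNIV) =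
    (\<Sum>u=1..N. ennreal (exp (2 * real u) * real (N choose u)) *
               (\<integral>\<^sup>+v. of_bool (fragment \<Lambda> W (mset v)) \<partial>replicate_pmf u p))"
proof -
  define c where "c u = ennreal (exp (2 * real u) * real (N choose u))" for u
  define q where "q u = map_pmf mset (replicate_pmf u p)" for u
  \<comment> \<open>\<open>q u\<close> charges only multisets of size \<open>u\<close>, so each
    \<open>U\<close> contributes to at most one summand.\<close>
  have q0: "pmf (q u) U = 0" if "u \<noteq> size U" for u U
    using that unfolding q_def by (intro pmf_eq_0_set_pmf[THEN iffD2]) (auto simp: set_replicate_pmf)
  have "ennreal (cost N p U) * of_bool (fragment \<Lambda> W U \<and> 1 \<le> size U \<and> size U \<le> N) =
        (\<Sum>u=1..N. c u * (ennreal (pmf (q u) U) * of_bool (fragment \<Lambda> W U)))" for U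
  proof -
    have "(\<Sum>u=1..N. c u * (ennreal (pmf (q u) U) * of_bool (fragment \<Lambda> W U))) =
          (\<Sum>u=1..N. if u = size U then c u * (ennreal (pmf (q u) U) * of_bool (fragment \<Lambda> W U)) else 0)"
      by (intro sum.cong) (auto simp: q0)
    also have "\<dots> = ennreal (cost N p U) * of_bool (fragment \<Lambda> W U \<and> 1 \<le> size U \<and> size U \<le> N)"
      by (auto simp: c_def q_def cost_def ennreal_mult' mult.assoc)
    finally show ?thesis by simp
  qed
  then have "(\<integral>\<^sup>+U. ennreal (cost N p U) * of_bool (fragment \<Lambda> W U \<and> 1 \<le> size U \<and> size U \<le> N) \<partial>count_space UNIV) =
    (\<Sum>u=1..N. c u * (\<integral>\<^sup>+U. ennreal (pmf (q u) U) * of_bool (fragment \<Lambda> W U) \<partial>count_space UNIV))"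
    by (simp add: nn_integral_sum nn_integral_cmult)
  also have "\<dots> = (\<Sum>u=1..N. c u * (\<integral>\<^sup>+U. of_bool (fragment \<Lambda> W U) \<partial>q u))"
    by (simp add: nn_integral_measure_pmf)
  finally show ?thesis by (simp add: q_def c_def)
qed

text \<open>From \<open>u\<close> to \<open>Suc u\<close> the left side is multiplied by
  \<open>k * (n - u) / (u + 1)\<close> and the right side by
  \<open>(k * n + u + 1) / (u + 1)\<close>, which is larger.\<close>

lemma binomial_scale:
  "real (n choose u) * real k ^ u \<le> real (k * n + u choose u)"
proof (induction u)
  case (Suc u)
  show ?case
  proof (cases "u < n")
    case True
    have 1: "real (n choose Suc u) * real (Suc u) = real (n choose u) * real (n - u)"
    proof -
      have "(n choose Suc u) * Suc u = (n choose u) * (n - u)"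
        using binomial_absorb_comp[of n u] binomial_absorption[of u n]
        by (simp only: mult.commute)
      then show ?thesis by (simp only: flip: of_nat_mult)
    qed
    have 2: "real (k * n + Suc u choose Suc u) * real (Suc u) = real (k * n + u + 1) * real (k * n + u choose u)"
    proof -
      have "(k * n + Suc u choose Suc u) * Suc u = (k * n + u + 1) * (k * n + u choose u)"
        using Suc_times_binomial_eq[of "k * n + u" u] by (simp del: binomial_Suc_Suc)
      then show ?thesis by (simp only: flip: of_nat_mult)
    qed
    have "real (n choose Suc u) * real k ^ Suc u * real (Suc u) =
          (real (n choose Suc u) * real (Suc u)) * (real k * real k ^ u)"
      by simp
    also have "\<dots> = (real (n choose u) * real k ^ u) * (real k * real (n - u))"
      unfolding 1 by simp
    also have "\<dots> \<le> real (k * n + u choose u) * (real k * real (n - u))"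
      using Suc.IH by (intro mult_right_mono) auto
    also have "\<dots> \<le> real (k * n + u choose u) * real (k * n + u + 1)"
    proof (intro mult_left_mono)
      have "k * (n - u) \<le> k * n" by (intro mult_le_mono2) simp
      then have "k * (n - u) \<le> k * n + u + 1" by linarith
      then have "real (k * (n - u)) \<le> real (k * n + u + 1)" by (simp only: of_nat_le_iff)
      then show "real k * real (n - u) \<le> real (k * n + u + 1)" by (simp only: of_nat_mult)
    qed auto
    also have "\<dots> = real (k * n + Suc u choose Suc u) * real (Suc u)" using 2 by simp
    finally show ?thesis by (simp del: of_nat_Suc binomial_Suc_Suc)
  next
    case False
    then show ?thesis by (simp add: binomial_eq_0 del: binomial_Suc_Suc)
  qed
qed auto

text \<open>The ratio is \<open>9 * 4 / 200\<close>: \<open>exp 2 \<le> 9\<close>, the 4 comes from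
  \<open>fragment_probability\<close>, and \<open>binomial_scale\<close> with \<open>k = 200\<close>
  compares the two binomial coefficients.\<close>

lemma fragment_cost_term:
  fixes p :: "'x pmf"
  shows "ennreal (exp (2 * real u) * real (N choose u)) *
    (\<integral>\<^sup>+w. \<integral>\<^sup>+v. of_bool (fragment \<Lambda> (mset w) (mset v)) \<partial>replicate_pmf u p \<partial>replicate_pmf (200 * N) p)
    \<le> ennreal ((9 / 50) ^ u)" (is "_ * ?I \<le> _")
proof -
  let ?B = "200 * N + u choose u"
  have "?I \<le> (\<integral>\<^sup>+w. \<integral>\<^sup>+v. 1 \<partial>replicate_pmf u p \<partial>replicate_pmf (200 * N) p)"
    by (intro nn_integral_mono) auto
  then have "?I \<le> 1" by simp
  then obtain r where r: "0 \<le> r" "?I = ennreal r"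
    by (cases ?I) (auto simp: top_unique)
  have "of_nat ?B * ennreal r \<le> 4 ^ u" using fragment_probability[where m = "200 * N" and u = u and \<Lambda> = \<Lambda> and p = p] r(2) by simp
  moreover have "of_nat ?B * ennreal r = ennreal (real ?B * r)"
    by (simp add: ennreal_mult' ennreal_of_nat_eq_real_of_nat)
  moreover have "(4 :: ennreal) ^ u = ennreal (4 ^ u)"
    by (simp flip: ennreal_numeral ennreal_power)
  ultimately have Br: "real ?B * r \<le> 4 ^ u" by simp
  have "exp 1 ^ 2 \<le> (3 :: real) ^ 2" using exp_le by (intro power_mono) auto
  then have "(exp 1 ^ 2) ^ u \<le> (9 :: real) ^ u" by (intro power_mono) auto
  moreover have "(exp 1 ^ 2) ^ u = exp (real (2 * u) * 1)"
    by (simp only: exp_of_nat_mult power_mult)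
  ultimately have "exp (2 * real u) \<le> 9 ^ u" by simp
  then have "exp (2 * real u) * (real (N choose u) * 200 ^ u * r) \<le> 9 ^ u * (real ?B * r)"
    using binomial_scale[of N u 200] r(1) by (intro mult_mono mult_right_mono) auto
  also have "\<dots> \<le> 9 ^ u * 4 ^ u" using Br by simp
  also have "\<dots> = (9 / 50) ^ u * 200 ^ u" by (simp flip: power_mult_distrib)
  finally have "exp (2 * real u) * real (N choose u) * r \<le> (9 / 50) ^ u"
    by (simp add: mult_ac)
  then show ?thesis using r by (simp flip: ennreal_mult')
qed

section \<open>The choice of the auxiliary sample\<close>

lemma nn_integral_SUP_replicate_mult:
  fixes p :: "'x pmf" and l :: "'i \<Rightarrow> 'x \<Rightarrow> real"
  assumes "\<And>i x. i \<in> I \<Longrightarrow> 0 \<le> l i x"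
  shows "(\<integral>\<^sup>+w. (SUP i\<in>I. ennreal (\<Sum>x\<leftarrow>w. l i x)) \<partial>replicate_pmf (k * N) p)
    \<le> of_nat k * (\<integral>\<^sup>+w. (SUP i\<in>I. ennreal (\<Sum>x\<leftarrow>w. l i x)) \<partial>replicate_pmf N p)"
proof (induction k)
  case 0
  then show ?case by (cases "I = {}") (auto simp: bot_ennreal)
next
  case (Suc k)
  let ?a = "\<lambda>w. SUP i\<in>I. ennreal (\<Sum>x\<leftarrow>w. l i x)"
  \<comment> \<open>The supremum is subadditive under concatenation, so each further block of
    \<open>N\<close> points adds at most the mean of one block.\<close>
  have sub: "?a (v @ w) \<le> ?a v + ?a w" for v w
  proof (rule SUP_least)
    fix i assume i: "i \<in> I"
    have "ennreal (\<Sum>x\<leftarrow>v @ w. l i x) = ennreal (\<Sum>x\<leftarrow>v. l i x) + ennreal (\<Sum>x\<leftarrow>w. l i x)"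
      using assms i by (subst ennreal_plus[symmetric]) (auto intro!: sum_list_nonneg)
    also have "\<dots> \<le> ?a v + ?a w" using i by (intro add_mono SUP_upper)
    finally show "ennreal (\<Sum>x\<leftarrow>v @ w. l i x) \<le> ?a v + ?a w" .
  qed
  have "(\<integral>\<^sup>+w. ?a w \<partial>replicate_pmf (Suc k * N) p) =
        (\<integral>\<^sup>+v. \<integral>\<^sup>+w. ?a (v @ w) \<partial>replicate_pmf (k * N) p \<partial>replicate_pmf N p)"
    by (simp add: replicate_pmf_distrib del: map_append sum_list_append)
  also have "\<dots> \<le> (\<integral>\<^sup>+v. \<integral>\<^sup>+w. ?a v + ?a w \<partial>replicate_pmf (k * N) p \<partial>replicate_pmf N p)"
    by (intro nn_integral_mono sub)
  also have "\<dots> = (\<integral>\<^sup>+v. ?a v \<partial>replicate_pmf N p) + (\<integral>\<^sup>+w. ?a w \<partial>replicate_pmf (k * N) p)"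
    by (simp add: nn_integral_add)
  also have "\<dots> \<le> of_nat (Suc k) * (\<integral>\<^sup>+w. ?a w \<partial>replicate_pmf N p)"
    using Suc.IH by (auto simp: distrib_right intro: add_left_mono)
  finally show ?case .
qed

text \<open>\<open>S\<close> itself qualifies with \<open>s = 0\<close>, so a smallest qualifying
  \<open>U\<close> exists. Were it empty, \<open>good\<close> would force twice the mass of
  \<open>W\<close> to reach 1, which the bound 1/2 excludes.\<close>

lemma exists_fragment:
  assumes nonneg: "\<And>l x. l \<in> \<Lambda> \<Longrightarrow> 0 \<le> l x"
    and small: "\<And>l. l \<in> \<Lambda> \<Longrightarrow> (\<Sum>x\<in>#W. l x) < 1 / 2"
    and l: "l \<in> \<Lambda>" "1 \<le> (\<Sum>x\<in>#S. l x)"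
  shows "\<exists>U. fragment \<Lambda> W U \<and> U \<subseteq># S \<and> U \<noteq> {#}"
proof -
  define P where "P V \<longleftrightarrow> V \<subseteq># S \<and> good \<Lambda> (W + V) (size V)" for V
  have "(\<Sum>x\<in>#W + S. l x + min (l x) 0) = (\<Sum>x\<in>#W + S. l x)"
    using nonneg[OF l(1)] by (intro arg_cong[of _ _ sum_mset] image_mset_cong) (simp add: min_def order.antisym)
  moreover have "0 \<le> (\<Sum>x\<in>#W. l x)" using nonneg[OF l(1)] by (induction W) auto
  ultimately have "good \<Lambda> (W + S) (size S)"
    unfolding good_def using l by (intro bexI[of _ l] exI[of _ 0]) auto
  then have "P S" by (simp add: P_def)
  \<comment> \<open>Least size implies minimality for inclusion, since a proper submultiset is
    strictly smaller.\<close>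
  then obtain U where U: "P U" and min: "\<And>V. P V \<Longrightarrow> size U \<le> size V"
    using ex_has_least_nat[of P S size] by blast
  have "fragment \<Lambda> W U"
    unfolding fragment_def
  proof (intro conjI allI impI notI)
    show "good \<Lambda> (W + U) (size U)" using U by (simp add: P_def)
    fix V assume "V \<subset># U" "good \<Lambda> (W + V) (size V)"
    then show False using U min[of V] mset_subset_size[of V U]
      by (auto simp: P_def subset_mset.less_le_trans dest: subset_mset.less_imp_le intro: subset_mset.order_trans)
  qed
  moreover have "U \<noteq> {#}"
  proof
    assume "U = {#}"
    then obtain m s where ms: "m \<in> \<Lambda>" "1 \<le> (\<Sum>x\<in>#W. m x + min (m x) s)"
      using U by (auto simp: P_def good_def)
    have "(\<Sum>x\<in>#W. m x + min (m x) s) \<le> (\<Sum>x\<in>#W. m x + m x)"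
      by (intro sum_mset_mono) auto
    also have "\<dots> = 2 * (\<Sum>x\<in>#W. m x)" by (simp add: sum_mset_distrib_left)
    finally show False using ms small[of m] by simp
  qed
  ultimately show ?thesis using U by (auto simp: P_def)
qed

text \<open>A first-moment argument over samples \<open>w\<close> of length \<open>200 * N\<close>:
  some \<open>w\<close> has a small supremum and cheap fragments at the same time, and its fragments
  form the required family.\<close>

lemma fragment_cover:
  fixes p :: "'x pmf"
  assumes nonneg: "\<And>l x. l \<in> \<Lambda> \<Longrightarrow> 0 \<le> l x"
    and mean: "(\<integral>\<^sup>+y. (SUP l\<in>\<Lambda>. ennreal (\<Sum>x\<leftarrow>y. l x)) \<partial>replicate_pmf N p) \<le> ennreal (1 / 800)"
  obtains \<U> where "\<And>U. U \<in> \<U> \<Longrightarrow> U \<noteq> {#} \<and> size U \<le> N"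
    and "\<And>l y. \<lbrakk>l \<in> \<Lambda>; length y = N; 1 \<le> (\<Sum>x\<leftarrow>y. l x)\<rbrakk> \<Longrightarrow> \<exists>U\<in>\<U>. U \<subseteq># mset y"
    and "(\<integral>\<^sup>+U. ennreal (cost N p U) \<partial>count_space \<U>) \<le> ennreal (1 / 2)"
proof -
  let ?R = "replicate_pmf (200 * N) p"
  define a where "a w = (SUP l\<in>\<Lambda>. ennreal (\<Sum>x\<leftarrow>w. l x))" for w
  define \<U> where "\<U> w = {U. fragment \<Lambda> (mset w) U \<and> 1 \<le> size U \<and> size U \<le> N}" for w
  define T where "T w = (\<integral>\<^sup>+U. ennreal (cost N p U) \<partial>count_space (\<U> w))" for w
  have T_eq: "T w = (\<Sum>u=1..N. ennreal (exp (2 * real u) * real (N choose u)) *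
               (\<integral>\<^sup>+v. of_bool (fragment \<Lambda> (mset w) (mset v)) \<partial>replicate_pmf u p))" for w
  proof -
    have "T w = (\<integral>\<^sup>+U. ennreal (cost N p U) * indicator (\<U> w) U \<partial>count_space UNIV)"
      unfolding T_def by (rule nn_integral_count_space_indicator) auto
    also have "\<dots> = (\<integral>\<^sup>+U. ennreal (cost N p U) * of_bool (fragment \<Lambda> (mset w) U \<and> 1 \<le> size U \<and> size U \<le> N) \<partial>count_space UNIV)"
      by (intro nn_integral_cong) (auto simp: \<U>_def indicator_def)
    finally show ?thesis unfolding fragment_total_cost .
  qed
  have "(\<integral>\<^sup>+w. T w \<partial>?R) = (\<Sum>u=1..N. ennreal (exp (2 * real u) * real (N choose u)) *
      (\<integral>\<^sup>+w. \<integral>\<^sup>+v. of_bool (fragment \<Lambda> (mset w) (mset v)) \<partial>replicate_pmf u p \<partial>?R))"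
    unfolding T_eq by (simp add: nn_integral_sum nn_integral_cmult)
  also have "\<dots> \<le> (\<Sum>u=1..N. ennreal ((9 / 50) ^ u))"
    by (intro sum_mono fragment_cost_term)
  also have "\<dots> = ennreal (\<Sum>u=1..N. (9 / 50) ^ u)" by (rule sum_ennreal) auto
  also have "\<dots> \<le> ennreal (9 / 41)"
  proof (rule ennreal_leI)
    \<comment> \<open>For \<open>r = 9 / 50\<close> the infinite series has the value
      \<open>r / (1 - r) = 9 / 41\<close>.\<close>
    have "(\<Sum>u=1..N. r ^ u) * (1 - r) = r - r * r ^ N" for r :: real
    proof (induction N)
      case (Suc N)
      then show ?case by (simp add: distrib_right) (simp add: algebra_simps)
    qed simp
    from this[of "9 / 50"] show "(\<Sum>u=1..N. (9 / 50 :: real) ^ u) \<le> 9 / 41"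
      by (simp add: power_divide)
  qed
  finally have ET: "(\<integral>\<^sup>+w. T w \<partial>?R) \<le> ennreal (9 / 41)" .
  have "(\<integral>\<^sup>+w. a w \<partial>?R) \<le> of_nat 200 * ennreal (1 / 800)"
  proof -
    have "(\<integral>\<^sup>+w. a w \<partial>?R) \<le> of_nat 200 * (\<integral>\<^sup>+w. a w \<partial>replicate_pmf N p)"
      unfolding a_def by (rule nn_integral_SUP_replicate_mult) (rule nonneg)
    also have "\<dots> \<le> of_nat 200 * ennreal (1 / 800)"
      using mean unfolding a_def by (intro mult_left_mono) auto
    finally show ?thesis .
  qed
  also have "\<dots> = ennreal (1 / 4)"
    by (simp flip: ennreal_numeral ennreal_mult)
  finally have Ea: "(\<integral>\<^sup>+w. a w \<partial>?R) \<le> ennreal (1 / 4)" .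
  have "\<exists>w. a w < ennreal (1 / 2) \<and> T w \<le> ennreal (1 / 2)"
  proof (rule ccontr)
    assume neg: "\<nexists>w. a w < ennreal (1 / 2) \<and> T w \<le> ennreal (1 / 2)"
    \<comment> \<open>Markov's inequality for both quantities at once: the thresholds are 1/2, while
      twice the sum of the two means is at most \<open>1 / 2 + 18 / 41\<close>, which is below
      1.\<close>
    have "1 \<le> 2 * a w + 2 * T w" for w
    proof -
      have two: "2 * ennreal (1 / 2) = 1" using ennreal_mult[of 2 "1 / 2"] by simp
      consider "ennreal (1 / 2) \<le> a w" | "ennreal (1 / 2) \<le> T w" using neg by (meson linorder_not_le order.strict_implies_order)
      then show ?thesis
      proof cases
        case 1
        then have "2 * ennreal (1 / 2) \<le> 2 * a w" by (rule mult_left_mono) auto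
        then show ?thesis unfolding two by (rule add_increasing2[rotated]) auto
      next
        case 2
        then have "2 * ennreal (1 / 2) \<le> 2 * T w" by (rule mult_left_mono) auto
        then show ?thesis unfolding two by (rule add_increasing[rotated]) auto
      qed
    qed
    then have "(\<integral>\<^sup>+w. 1 \<partial>?R) \<le> (\<integral>\<^sup>+w. 2 * a w + 2 * T w \<partial>?R)" by (intro nn_integral_mono)
    also have "\<dots> = 2 * (\<integral>\<^sup>+w. a w \<partial>?R) + 2 * (\<integral>\<^sup>+w. T w \<partial>?R)"
      by (simp add: nn_integral_add nn_integral_cmult)
    also have "\<dots> \<le> 2 * ennreal (1 / 4) + 2 * ennreal (9 / 41)"
      using Ea ET by (intro add_mono mult_left_mono) auto
    also have "\<dots> = ennreal (2 * (1 / 4) + 2 * (9 / 41))"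
    proof -
      have "2 * ennreal x = ennreal (2 * x)" if "0 \<le> x" for x
        using that ennreal_mult[of 2 x] by simp
      then show ?thesis using ennreal_plus[of "2 * (1 / 4)" "2 * (9 / 41)"] by (simp only:)
    qed
    also have "\<dots> < 1" by simp
    finally show False by simp
  qed
  then obtain w where w: "a w < ennreal (1 / 2)" "T w \<le> ennreal (1 / 2)" by blast
  have small: "(\<Sum>x\<in>#mset w. l x) < 1 / 2" if "l \<in> \<Lambda>" for l
  proof -
    have "ennreal (\<Sum>x\<leftarrow>w. l x) \<le> a w" unfolding a_def using that by (rule SUP_upper)
    also note w(1)
    finally have "(\<Sum>x\<leftarrow>w. l x) < 1 / 2" by (subst (asm) ennreal_less_iff) (auto intro!: sum_list_nonneg nonneg[OF that])
    then show ?thesis by (simp flip: sum_mset_sum_list)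
  qed
  show ?thesis
  proof (rule that)
    fix l y assume l: "l \<in> \<Lambda>" and y: "length y = N" and ly: "1 \<le> (\<Sum>x\<leftarrow>y. l x)"
    have "\<exists>U. fragment \<Lambda> (mset w) U \<and> U \<subseteq># mset y \<and> U \<noteq> {#}"
    proof (rule exists_fragment)
      show "1 \<le> (\<Sum>x\<in>#mset y. l x)" using ly by (simp flip: sum_mset_sum_list)
    qed (fact nonneg small l)+
    then obtain U where "fragment \<Lambda> (mset w) U" "U \<subseteq># mset y" "U \<noteq> {#}" by blast
    moreover from this have "size U \<le> N" using size_mset_mono[of U "mset y"] y by simp
    ultimately show "\<exists>U\<in>\<U> w. U \<subseteq># mset y"
      by (intro bexI[of _ U]) (auto simp: \<U>_def Suc_le_eq nonempty_has_size)
  qed (use w(2) in \<open>auto simp: \<U>_def T_def\<close>)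
qed

section \<open>Half-spaces through a fragment\<close>

lemma pmf_replicate_pmf_length: "pmf (replicate_pmf (length xs) p) xs = prod_list (map (pmf p) xs)"
proof (induction xs)
  case (Cons x xs)
  have "replicate_pmf (length (x # xs)) p = map_pmf (\<lambda>(y, ys). y # ys) (pair_pmf p (replicate_pmf (length xs) p))"
    by (simp add: pair_pmf_def map_bind_pmf)
  moreover have "pmf (map_pmf (\<lambda>(y, ys). y # ys) (pair_pmf p (replicate_pmf (length xs) p))) ((\<lambda>(y, ys). y # ys) (x, xs))
      = pmf (pair_pmf p (replicate_pmf (length xs) p)) (x, xs)"
    by (rule pmf_map_inj') (auto intro!: injI)
  ultimately show ?case using Cons.IH by (simp add: pmf_pair)
qed simp

lemma pmf_mset_replicate_pmf:
  "pmf (map_pmf mset (replicate_pmf (size U) p)) U =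
   real (card (permutations_of_multiset U)) * (\<Prod>x\<in>#U. pmf p x)"
proof -
  have "pmf (map_pmf mset (replicate_pmf (size U) p)) U =
        measure (replicate_pmf (size U) p) (permutations_of_multiset U)"
    by (simp add: pmf_map permutations_of_multiset_def vimage_def)
  also have "\<dots> = (\<Sum>xs\<in>permutations_of_multiset U. pmf (replicate_pmf (size U) p) xs)"
    by (rule measure_measure_pmf_finite) auto
  also have "\<dots> = (\<Sum>xs\<in>permutations_of_multiset U. (\<Prod>x\<in>#U. pmf p x))"
  proof (rule sum.cong)
    fix xs assume "xs \<in> permutations_of_multiset U"
    then have "mset xs = U" by (rule permutations_of_multisetD)
    then show "pmf (replicate_pmf (size U) p) xs = (\<Prod>x\<in>#U. pmf p x)"
      by (auto simp: pmf_replicate_pmf_length simp flip: prod_mset_prod_list)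
  qed simp
  finally show ?thesis by simp
qed

text \<open>\<open>n ^ n / fact n\<close> is a single term of the series for
  \<open>exp n\<close>.\<close>

lemma fact_ge_power_exp: "(real n / exp 1) ^ n \<le> fact n"
proof -
  have "real n ^ n / fact n \<le> exp (real n)"
    using sum_le_suminf[OF summable_exp_generic[of "real n"], of "{n}"]
    by (simp add: exp_def divide_inverse mult.commute scaleR_conv_of_real)
  then have "real n ^ n \<le> exp 1 ^ n * fact n"
    by (simp add: divide_le_eq flip: exp_of_nat_mult)
  then show ?thesis by (simp add: power_divide divide_le_eq mult.commute)
qed

text \<open>Brings the cost into the form that the exponential moment bound produces. The
  multinomial coefficient is estimated by \<open>fact c \<le> c ^ c\<close> for each multiplicity
  \<open>c\<close>, and \<open>(N choose u) * fact u\<close> is at least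
  \<open>(N / exp 1) ^ u\<close>. This uses up one of the two factors \<open>exp u\<close> in
  \<open>cost\<close>; the other stays on the left.\<close>

lemma cost_ge_prod:
  assumes "U \<noteq> {#}" "size U \<le> N"
  shows "exp (real (size U)) * (\<Prod>x\<in>#U. real N * pmf p x / real (count U x)) \<le> cost N p U"
proof -
  define u where "u = size U"
  define P where "P = (\<Prod>x\<in>#U. pmf p x)"
  define Q where "Q = (\<Prod>x\<in>#U. real (count U x))"
  define F where "F = (\<Prod>x\<in>set_mset U. fact (count U x) :: real)"
  have u: "u > 0" using assms(1) by (simp add: u_def nonempty_has_size)
  have P0: "0 \<le> P" unfolding P_def by (induction U) auto
  have Q_eq: "Q = (\<Prod>x\<in>set_mset U. real (count U x) ^ count U x)"
    unfolding Q_def by (simp add: image_prod_mset_multiplicity)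
  have Q0: "0 < Q" unfolding Q_eq by (intro prod_pos) (auto simp: count_greater_zero_iff)
  have F0: "0 < F" unfolding F_def by (intro prod_pos) auto
  have FQ: "F \<le> Q"
    unfolding F_def Q_eq
  proof (intro prod_mono conjI)
    fix x
    show "fact (count U x) \<le> real (count U x) ^ count U x"
      using fact_le_power[of "count U x"] by (metis le_refl of_nat_fact of_nat_le_iff of_nat_power)
  qed auto
  have card: "real (card (permutations_of_multiset U)) = fact u / F"
  proof -
    have "real (card (permutations_of_multiset U) * (\<Prod>x\<in>set_mset U. fact (count U x))) = real (fact u)"
      using card_permutations_of_multiset_aux[of U] by (simp only: u_def)
    then show ?thesis using F0 by (simp add: F_def field_simps)
  qed
  have "(\<Prod>x\<in>#U. real N * pmf p x / real (count U x)) = real N ^ u * P / Q"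
    unfolding u_def P_def Q_def
  proof -
    have "(\<Prod>x\<in>#V. real N * pmf p x / real (count U x)) =
      real N ^ size V * (\<Prod>x\<in>#V. pmf p x) / (\<Prod>x\<in>#V. real (count U x))" for V
      by (induction V) auto
    then show "(\<Prod>x\<in>#U. real N * pmf p x / real (count U x)) =
      real N ^ size U * (\<Prod>x\<in>#U. pmf p x) / (\<Prod>x\<in>#U. real (count U x))" .
  qed
  then have "exp (real u) * (\<Prod>x\<in>#U. real N * pmf p x / real (count U x)) = exp (real u) * real N ^ u * P / Q"
    by simp
  also have "\<dots> \<le> exp (real u) * real N ^ u * P / F"
    using FQ F0 P0 Q0 by (intro divide_left_mono) auto
  also have "\<dots> \<le> (exp (2 * real u) * (real (N choose u) * fact u)) * P / F"
  proof (intro divide_right_mono mult_right_mono)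
    have "(real N / real u) ^ u * (real u / exp 1) ^ u \<le> real (N choose u) * fact u"
      using assms(2) binomial_ge_n_over_k_pow_k[of u N, where 'a = real] fact_ge_power_exp[of u]
      by (intro mult_mono) (auto simp: u_def)
    moreover have "(real N / real u) ^ u * (real u / exp 1) ^ u = real N ^ u / exp (real u)"
      using u by (simp add: power_divide flip: exp_of_nat_mult)
    ultimately have "exp (2 * real u) * (real N ^ u / exp (real u)) \<le> exp (2 * real u) * (real (N choose u) * fact u)"
      by (intro mult_left_mono) simp_all
    moreover have "exp (2 * real u) * (real N ^ u / exp (real u)) = exp (real u) * real N ^ u"
      by (simp add: mult_exp_exp[symmetric] exp_double power2_eq_square)
    ultimately show "exp (real u) * real N ^ u \<le> exp (2 * real u) * (real (N choose u) * fact u)"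
      by simp
  qed (use P0 F0 in auto)
  also have "\<dots> = cost N p U"
    unfolding cost_def pmf_mset_replicate_pmf card P_def[symmetric] by (simp add: u_def card)
  finally show ?thesis by (simp add: u_def)
qed

section \<open>The Chernoff bound\<close>

text \<open>The function whose half-space replaces the event that the sample contains \<open>U\<close>. Its
  exponential moment is \<open>1 + size U / N\<close>. Off the support of \<open>p\<close> it is \<open>0\<close>, because \<open>x / 0 = 0\<close>;
  hence \<open>U\<close> has to lie in the support.\<close>

definition tilt :: "nat \<Rightarrow> 'x pmf \<Rightarrow> 'x multiset \<Rightarrow> 'x \<Rightarrow> real" where
  "tilt N p U x = ln (1 + real (count U x) / (real N * pmf p x))"

lemma tilt_nonneg: "0 \<le> tilt N p U x"
  by (simp add: tilt_def)

text \<open>The half-spaces of a cover need strictly positive thresholds.\<close>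

lemma tilt_sum_pos:
  assumes "U \<noteq> {#}" "set_mset U \<subseteq> set_pmf p" "0 < N"
  shows "0 < (\<Sum>x\<in>#U. tilt N p U x)"
proof -
  obtain x where x: "x \<in># U" using assms(1) by blast
  then obtain V where V: "U = add_mset x V" by (metis insert_DiffM)
  have "0 < real (count U x) / (real N * pmf p x)"
    using x assms(2,3) by (auto intro!: divide_pos_pos simp: pmf_positive_iff)
  then have "0 < tilt N p U x" unfolding tilt_def by (intro ln_gt_zero) simp
  moreover have "0 \<le> (\<Sum>y\<in>#V. tilt N p U y)" by (induction V) (auto simp: tilt_nonneg)
  ultimately show ?thesis by (subst V) simp
qed

lemma nn_integral_exp_replicate_pmf:
  fixes g :: "'x \<Rightarrow> real"
  shows "(\<integral>\<^sup>+y. ennreal (exp (\<Sum>x\<leftarrow>y. g x)) \<partial>replicate_pmf n p) =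
         (\<integral>\<^sup>+x. ennreal (exp (g x)) \<partial>p) ^ n"
proof (induction n)
  case (Suc n)
  have "(\<integral>\<^sup>+y. ennreal (exp (\<Sum>x\<leftarrow>y. g x)) \<partial>replicate_pmf (Suc n) p) =
    (\<integral>\<^sup>+x. \<integral>\<^sup>+y. ennreal (exp (g x)) * ennreal (exp (\<Sum>x\<leftarrow>y. g x)) \<partial>replicate_pmf n p \<partial>p)"
    unfolding nn_integral_replicate_pmf_Suc by (simp add: exp_add ennreal_mult')
  then show ?case using Suc.IH by (simp add: nn_integral_cmult nn_integral_multc)
qed simp

text \<open>Markov's inequality for the exponential of the sum: the moment is at most
  \<open>exp (size U)\<close>, and \<open>exp (- T)\<close> is at most the product in
  \<open>cost_ge_prod\<close>.\<close>

lemma tilt_tail_le_cost: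
  assumes "U \<noteq> {#}" "size U \<le> N" and sub: "set_mset U \<subseteq> set_pmf p"
  shows "emeasure (replicate_pmf N p) {y. (\<Sum>x\<in>#U. tilt N p U x) \<le> (\<Sum>x\<leftarrow>y. tilt N p U x)}
         \<le> ennreal (cost N p U)"
proof -
  define T where "T = (\<Sum>x\<in>#U. tilt N p U x)"
  have u: "size U > 0" using assms(1) by (simp add: nonempty_has_size)
  then have N: "N > 0" using assms(2) by simp
  have exp_tilt: "exp (tilt N p U x) = 1 + real (count U x) / (real N * pmf p x)" for x
    unfolding tilt_def by (subst exp_ln) (auto intro: add_pos_nonneg)
  have "(\<integral>\<^sup>+x. ennreal (exp (tilt N p U x)) \<partial>p) =
        (\<integral>\<^sup>+x. 1 + ennreal (real (count U x) / (real N * pmf p x)) \<partial>p)"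
    unfolding exp_tilt by (intro nn_integral_cong) simp
  also have "\<dots> = 1 + (\<integral>\<^sup>+x. ennreal (real (count U x) / (real N * pmf p x)) \<partial>p)"
    by (simp add: nn_integral_add)
  also have "(\<integral>\<^sup>+x. ennreal (real (count U x) / (real N * pmf p x)) \<partial>p) =
        (\<Sum>x\<in>set_mset U. ennreal (real (count U x) / (real N * pmf p x)) * ennreal (pmf p x))"
    by (rule nn_integral_measure_pmf_support) (auto simp: not_in_iff)
  \<comment> \<open>The factor \<open>pmf p x\<close> cancels because it is nonzero on
    \<open>U\<close>.\<close>
  also have "\<dots> = (\<Sum>x\<in>set_mset U. ennreal (real (count U x) / real N))"
    using sub by (intro sum.cong refl) (auto simp: ennreal_mult'[symmetric] set_pmf_iff subset_iff)
  also have "\<dots> = ennreal (real (size U) / real N)"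
    by (simp add: sum_ennreal size_multiset_overloaded_eq flip: sum_divide_distrib)
  finally have "(\<integral>\<^sup>+x. ennreal (exp (tilt N p U x)) \<partial>p) = ennreal (1 + real (size U) / real N)"
    by simp
  then have mgf: "(\<integral>\<^sup>+y. ennreal (exp (\<Sum>x\<leftarrow>y. tilt N p U x)) \<partial>replicate_pmf N p) =
      ennreal ((1 + real (size U) / real N) ^ N)"
    using ennreal_power[of "1 + real (size U) / real N" N]
    unfolding nn_integral_exp_replicate_pmf by simp
  have "emeasure (replicate_pmf N p) {y. T \<le> (\<Sum>x\<leftarrow>y. tilt N p U x)} =
        (\<integral>\<^sup>+y. indicator {y. T \<le> (\<Sum>x\<leftarrow>y. tilt N p U x)} y \<partial>replicate_pmf N p)"
    by simp
  also have "\<dots> \<le> (\<integral>\<^sup>+y. ennreal (exp (- T)) * ennreal (exp (\<Sum>x\<leftarrow>y. tilt N p U x)) \<partial>replicate_pmf N p)"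
  proof (intro nn_integral_mono)
    fix y
    show "indicator {y. T \<le> (\<Sum>x\<leftarrow>y. tilt N p U x)} y \<le>
          ennreal (exp (- T)) * ennreal (exp (\<Sum>x\<leftarrow>y. tilt N p U x))"
      by (auto simp: indicator_def simp flip: ennreal_mult' exp_add)
  qed
  also have "\<dots> = ennreal (exp (- T) * (1 + real (size U) / real N) ^ N)"
    by (simp add: nn_integral_cmult mgf ennreal_mult')
  also have "\<dots> \<le> ennreal (cost N p U)"
  proof (rule ennreal_leI)
    have "(1 + real (size U) / real N) ^ N \<le> exp (real (size U))"
      using exp_ge_one_plus_x_over_n_power_n[of N "real (size U)"] N by simp
    moreover have "exp (- T) \<le> (\<Prod>x\<in>#U. real N * pmf p x / real (count U x))"
    proof -
      \<comment> \<open>Only \<open>V\<close> varies in the induction; the tilt stays that of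
        \<open>U\<close>.\<close>
      have "exp (- (\<Sum>x\<in>#V. tilt N p U x)) \<le> (\<Prod>x\<in>#V. real N * pmf p x / real (count U x))" if "V \<subseteq># U" for V
        using that
      proof (induction V)
        case (add x V)
        have x: "x \<in># U" using add.prems by (meson mset_subset_eqD union_single_eq_member)
        have pos: "0 < real N * pmf p x" "0 < real (count U x)"
          using x sub N by (auto simp: pmf_positive_iff)
        \<comment> \<open>This is \<open>1 / (1 + r) \<le> 1 / r\<close> with
          \<open>r = count U x / (N * pmf p x)\<close>.\<close>
        have "exp (- tilt N p U x) \<le> real N * pmf p x / real (count U x)"
          unfolding exp_minus exp_tilt
          using pos le_imp_inverse_le[of "real (count U x) / (real N * pmf p x)"
              "1 + real (count U x) / (real N * pmf p x)"] by simp
        moreover have "V \<subseteq># U" using add.prems by (metis subset_mset.order_trans mset_subset_eq_add_right add_mset_add_single mset_subset_eq_add_left)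
        ultimately show ?case using add.IH by (simp add: exp_diff exp_minus divide_inverse mult_mono)
      qed simp
      then show ?thesis by (simp add: T_def)
    qed
    ultimately have "exp (- T) * (1 + real (size U) / real N) ^ N \<le>
       (\<Prod>x\<in>#U. real N * pmf p x / real (count U x)) * exp (real (size U))"
      by (intro mult_mono) (auto intro: order.trans[OF _ \<open>exp (- T) \<le> _\<close>])
    also have "\<dots> \<le> cost N p U" using cost_ge_prod[OF assms(1,2)] by (simp add: mult.commute)
    finally show "exp (- T) * (1 + real (size U) / real N) ^ N \<le> cost N p U" .
  qed
  finally show ?thesis by (simp add: T_def)
qed

section \<open>Discretisation\<close>

lemma pmf_of_countable_prob_space:
  fixes \<mu> :: "'x::countable measure"
  assumes "prob_space \<mu>" "sets \<mu> = UNIV"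
  shows "\<exists>p. measure_pmf p = \<mu>"
proof -
  have space: "space \<mu> = UNIV" using assms(2) sets_eq_imp_space_eq[of \<mu> "count_space UNIV"] by simp
  \<comment> \<open>A pmf requires almost every point to have positive mass; the points of mass zero
    are countably many, hence jointly null.\<close>
  have "AE x in \<mu>. x = y \<longrightarrow> measure \<mu> {x} \<noteq> 0" for y
  proof (cases "measure \<mu> {y} = 0")
    case True
    then have "emeasure \<mu> {y} = 0"
      using assms(1) by (simp add: finite_measure.emeasure_eq_measure prob_space.finite_measure)
    then show ?thesis by (intro AE_I[of _ _ "{y}"]) (auto simp: assms(2) space)
  qed auto
  then have "AE x in \<mu>. \<forall>y\<in>UNIV. x = y \<longrightarrow> measure \<mu> {x} \<noteq> 0"
    by (subst AE_ball_countable) auto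
  then have "AE x in \<mu>. measure \<mu> {x} \<noteq> 0" by simp
  then have "measure_pmf (Abs_pmf \<mu>) = \<mu>" using assms by (intro Abs_pmf_inverse) auto
  then show ?thesis by blast
qed

text \<open>Lists over a countable type form a countable type, so preimages of single lists
  suffice.\<close>

lemma measurable_map_upt:
  fixes Z :: "nat \<Rightarrow> 'w \<Rightarrow> 'x::countable"
  assumes "\<And>i. i < n \<Longrightarrow> Z i \<in> measurable M (count_space UNIV)"
  shows "(\<lambda>\<omega>. map (\<lambda>i. Z i \<omega>) [0..<n]) \<in> measurable M (count_space UNIV)"
  unfolding measurable_count_space_eq2_countable
proof (intro conjI ballI)
  fix ys :: "'x list"
  show "(\<lambda>\<omega>. map (\<lambda>i. Z i \<omega>) [0..<n]) -` {ys} \<inter> space M \<in> sets M"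
  proof (cases "length ys = n")
    case True
    have "map (\<lambda>i. Z i \<omega>) [0..<n] = ys \<longleftrightarrow> (\<forall>i\<in>{..<n}. Z i \<omega> \<in> {ys ! i})" for \<omega>
      using True by (auto simp: list_eq_iff_nth_eq)
    then have "(\<lambda>\<omega>. map (\<lambda>i. Z i \<omega>) [0..<n]) -` {ys} \<inter> space M =
          {\<omega> \<in> space M. \<forall>i\<in>{..<n}. Z i \<omega> \<in> {ys ! i}}"
      unfolding vimage_def by (simp only: singleton_iff) blast
    also have "\<dots> \<in> sets M"
    proof (rule sets.sets_Collect_finite_All)
      fix i assume "i \<in> {..<n}"
      then show "{\<omega> \<in> space M. Z i \<omega> \<in> {ys ! i}} \<in> sets M"
        using measurable_sets[OF assms, of i "{ys ! i}"]
        by (simp add: vimage_def Int_def conj_commute)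
    qed simp
    finally show ?thesis .
  next
    case False
    then have "(\<lambda>\<omega>. map (\<lambda>i. Z i \<omega>) [0..<n]) -` {ys} \<inter> space M = {}" by auto
    then show ?thesis by simp
  qed
qed auto

lemma (in prob_space) distr_iid_list:
  fixes Z :: "nat \<Rightarrow> 'a \<Rightarrow> 'x::countable"
  assumes indep: "indep_vars (\<lambda>_. count_space UNIV) Z {1..N}"
    and law: "\<And>i. i \<in> {1..N} \<Longrightarrow> distr M (count_space UNIV) (Z i) = measure_pmf p"
  shows "distr M (count_space UNIV) (\<lambda>\<omega>. map (\<lambda>i. Z (Suc i) \<omega>) [0..<N]) = measure_pmf (replicate_pmf N p)"
proof (rule measure_eqI_countable[where A = UNIV])
  have Z: "Z i \<in> measurable M (count_space UNIV)" if "i \<in> {1..N}" for i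
    using indep that by (auto simp: indep_vars_def)
  have meas: "(\<lambda>\<omega>. map (\<lambda>i. Z (Suc i) \<omega>) [0..<N]) \<in> measurable M (count_space UNIV)"
    by (rule measurable_map_upt) (use Z in auto)
  fix ys :: "'x list"
  let ?A = "(\<lambda>\<omega>. map (\<lambda>i. Z (Suc i) \<omega>) [0..<N]) -` {ys} \<inter> space M"
  have "emeasure (distr M (count_space UNIV) (\<lambda>\<omega>. map (\<lambda>i. Z (Suc i) \<omega>) [0..<N])) {ys} = ennreal (prob ?A)"
    by (simp add: emeasure_distr[OF meas] emeasure_eq_measure)
  also have "prob ?A = pmf (replicate_pmf N p) ys"
  proof (cases "length ys = N")
    case False
    then have "?A = {}" "ys \<notin> set_pmf (replicate_pmf N p)" by (auto simp: set_replicate_pmf)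
    then show ?thesis by (simp add: pmf_eq_0_set_pmf)
  next
    case len: True
    show ?thesis
    \<comment> \<open>For \<open>N = 0\<close> the intersection used below would be the whole type
      instead of \<open>space M\<close>.\<close>
    proof (cases "N = 0")
      case True
      then show ?thesis using len by (simp add: prob_space)
    next
      case False
      \<comment> \<open>Samples are indexed from 1 and lists from 0, hence
        \<open>i - 1\<close>.\<close>
      have "?A = (\<Inter>i\<in>{1..N}. Z i -` {ys ! (i - 1)} \<inter> space M)"
      proof (rule set_eqI)
        fix \<omega>
        have "(map (\<lambda>i. Z (Suc i) \<omega>) [0..<N] = ys) \<longleftrightarrow> (\<forall>i<N. Z (Suc i) \<omega> = ys ! i)"
          using len by (auto simp: list_eq_iff_nth_eq)
        also have "\<dots> \<longleftrightarrow> (\<forall>i\<in>{1..N}. Z i \<omega> = ys ! (i - 1))"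
        proof safe
          fix i assume *: "\<forall>i<N. Z (Suc i) \<omega> = ys ! i" "i \<in> {1..N}"
          then show "Z i \<omega> = ys ! (i - 1)" using *(1)[rule_format, of "i - 1"] by auto
        next
          fix i assume *: "\<forall>i\<in>{1..N}. Z i \<omega> = ys ! (i - 1)" "i < N"
          then show "Z (Suc i) \<omega> = ys ! i" using *(1)[rule_format, of "Suc i"] by auto
        qed
        finally show "\<omega> \<in> ?A \<longleftrightarrow> \<omega> \<in> (\<Inter>i\<in>{1..N}. Z i -` {ys ! (i - 1)} \<inter> space M)"
          using False by auto
      qed
      then have "prob ?A = (\<Prod>i\<in>{1..N}. prob (Z i -` {ys ! (i - 1)} \<inter> space M))"
        using indep_varsD_finite[OF indep, of "\<lambda>i. {ys ! (i - 1)}"] False by simp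
      also have "\<dots> = (\<Prod>i\<in>{1..N}. pmf p (ys ! (i - 1)))"
      proof (rule prod.cong)
        fix i assume i: "i \<in> {1..N}"
        have "prob (Z i -` {ys ! (i - 1)} \<inter> space M) =
              measure (distr M (count_space UNIV) (Z i)) {ys ! (i - 1)}"
          using Z[OF i] by (simp add: measure_distr)
        then show "prob (Z i -` {ys ! (i - 1)} \<inter> space M) = pmf p (ys ! (i - 1))"
          by (simp only: law[OF i] pmf.rep_eq)
      qed simp
      also have "\<dots> = prod_list (map (pmf p) ys)"
        using len by (simp add: prod.atLeast1_atMost_eq prod.list_conv_set_nth atLeast0LessThan)
      finally show ?thesis using pmf_replicate_pmf_length[of ys p] len by simp
    qed
  qed
  finally show "emeasure (distr M (count_space UNIV) (\<lambda>\<omega>. map (\<lambda>i. Z (Suc i) \<omega>) [0..<N])) {ys} =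
      emeasure (measure_pmf (replicate_pmf N p)) {ys}"
    by (simp add: emeasure_pmf_single)
qed auto

lemma sum_le_nn_integral_count_space:
  assumes "finite S" "S \<subseteq> A"
  shows "sum f S \<le> (\<integral>\<^sup>+x. f x \<partial>count_space A)"
proof -
  have "sum f S = (\<integral>\<^sup>+x. f x * indicator S x \<partial>count_space A)"
    using assms by (subst nn_integral_count_space'[of S]) (auto simp: indicator_def)
  also have "\<dots> \<le> (\<integral>\<^sup>+x. f x \<partial>count_space A)"
    by (intro nn_integral_mono) (auto simp: indicator_def)
  finally show ?thesis .
qed

text \<open>The image counts a value once even if several indices produce it, so a set of pairs
  never costs more than a family that enumerates it.\<close>

lemma infsum_image_le:
  fixes f :: "'b \<Rightarrow> ennreal"
  assumes "\<And>S. finite S \<Longrightarrow> S \<subseteq> A \<Longrightarrow> (\<Sum>x\<in>S. f (h x)) \<le> b"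
  shows "infsum f (h ` A) \<le> b"
proof -
  have "sum f S \<le> b" if S: "finite S" "S \<subseteq> h ` A" for S
  proof -
    obtain T where T: "T \<subseteq> A" "inj_on h T" "S = h ` T" using S(2) by (auto simp: subset_image_inj)
    then show ?thesis using assms[of T] S(1) by (simp add: sum.reindex finite_image_iff)
  qed
  then show ?thesis by (subst nonneg_infsum_complete) (auto intro: SUP_least)
qed

lemma measurable_discretize:
  fixes fs :: "('a::topological_space \<Rightarrow> real) list"
  assumes "\<And>f. f \<in> set fs \<Longrightarrow> f \<in> borel_measurable borel"
  shows "(\<lambda>x. map (\<lambda>f. nat \<lfloor>f x / e\<rfloor>) fs) \<in> measurable borel (count_space UNIV)"
proof -
  have "(\<lambda>x. map (\<lambda>i. nat \<lfloor>(fs ! i) x / e\<rfloor>) [0..<length fs]) \<in> measurable borel (count_space UNIV)"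
  proof (rule measurable_map_upt)
    fix i assume "i < length fs"
    then have [measurable]: "fs ! i \<in> borel_measurable borel" using assms by simp
    show "(\<lambda>x. nat \<lfloor>(fs ! i) x / e\<rfloor>) \<in> measurable borel (count_space UNIV)" by measurable
  qed
  moreover have "map (\<lambda>i. nat \<lfloor>(fs ! i) x / e\<rfloor>) [0..<length fs] = map (\<lambda>f. nat \<lfloor>f x / e\<rfloor>) fs" for x
    by (rule nth_equalityI) auto
  ultimately show ?thesis by simp
qed

lemma emp_mean_comp_sum_list:
  "emp_mean N Y (g \<circ> \<phi>) \<omega> = (\<Sum>x\<leftarrow>map (\<lambda>i. \<phi> (Y (Suc i) \<omega>)) [0..<N]. g x) / real N"
  by (simp add: emp_mean_def sum.atLeast1_atMost_eq interv_sum_list_conv_sum_set_nat atLeast0LessThan comp_def)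

text \<open>Rounding the functions down to multiples of the expected supremum \<open>e\<close> changes every empirical
  mean by at most \<open>e\<close>, so a law on a countable type suffices and no limit has to be taken.\<close>

lemma ex_small_cover:
  fixes \<nu> :: "'a::polish_space measure" and M :: "'w measure"
  assumes N: "0 < N" and "prob_space M" and iid: "iid_sample M \<nu> N Y" and "finite F"
    and F: "F \<subseteq> nonneg_borel" and pos: "0 < expected_sup M N Y F" and fin: "expected_sup M N Y F < \<infinity>"
  shows "\<exists>C. small_cover 801 M N Y F C"
proof -
  interpret prob_space M by fact
  obtain e where e: "expected_sup M N Y F = ennreal e" "0 < e"
    using pos fin by (cases "expected_sup M N Y F") auto
  obtain fs where fs: "set fs = F" using \<open>finite F\<close> finite_list by blast
  have f_borel: "f \<in> borel_measurable borel" and f_nonneg: "0 \<le> f x" if "f \<in> F" for f x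
    using that F by (auto simp: nonneg_borel_def)
  \<comment> \<open>The rounded values of all members at \<open>x\<close>, in units of
    \<open>e\<close>; lists of naturals form a countable type.\<close>
  define \<phi> where "\<phi> x = map (\<lambda>f. nat \<lfloor>f x / e\<rfloor>) fs" for x
  have \<phi>: "\<phi> \<in> measurable borel (count_space UNIV)"
    unfolding \<phi>_def by (rule measurable_discretize) (auto simp: fs f_borel)
  have Y: "Y i \<in> measurable M borel" if "i \<in> {1..N}" for i
    using iid that by (auto simp: iid_sample_def indep_vars_def)
  have "1 \<in> {1..N}" using N by simp
  then have Y1: "distr M borel (Y 1) = \<nu>" using iid by (auto simp: iid_sample_def)
  have "prob_space (distr M (count_space UNIV) (\<lambda>\<omega>. \<phi> (Y 1 \<omega>)))"
    using measurable_compose[OF Y[OF \<open>1 \<in> {1..N}\<close>] \<phi>] by (rule prob_space_distr)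
  then obtain p where p1: "measure_pmf p = distr M (count_space UNIV) (\<lambda>\<omega>. \<phi> (Y 1 \<omega>))"
    using pmf_of_countable_prob_space[of "distr M (count_space UNIV) (\<lambda>\<omega>. \<phi> (Y 1 \<omega>))"] by auto
  have law: "distr M (count_space UNIV) (\<lambda>\<omega>. \<phi> (Y i \<omega>)) = measure_pmf p" if i: "i \<in> {1..N}" for i
  proof -
    have "distr M (count_space UNIV) (\<lambda>\<omega>. \<phi> (Y j \<omega>)) = distr (distr M borel (Y j)) (count_space UNIV) \<phi>"
      if "j \<in> {1..N}" for j
      using distr_distr[OF \<phi> Y[OF that]] by (simp add: comp_def)
    moreover have "distr M borel (Y i) = \<nu>" using iid i by (auto simp: iid_sample_def)
    ultimately show ?thesis using i \<open>1 \<in> {1..N}\<close> Y1 p1 by simp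
  qed
  define R where "R \<omega> = map (\<lambda>i. \<phi> (Y (Suc i) \<omega>)) [0..<N]" for \<omega>
  have R: "R \<in> measurable M (count_space UNIV)"
    unfolding R_def by (rule measurable_map_upt) (auto intro!: measurable_compose[OF Y \<phi>])
  have "indep_vars (\<lambda>_. count_space UNIV) (\<lambda>i \<omega>. \<phi> (Y i \<omega>)) {1..N}"
    using iid by (auto simp: iid_sample_def intro!: indep_vars_compose2[where M' = "\<lambda>_. borel"] \<phi>)
  then have R_law: "distr M (count_space UNIV) R = measure_pmf (replicate_pmf N p)"
    unfolding R_def by (rule distr_iid_list) (rule law)
  have len_R: "length (R \<omega>) = N" for \<omega> by (simp add: R_def)
  have mean_g: "emp_mean N Y (g \<circ> \<phi>) \<omega> = (\<Sum>x\<leftarrow>R \<omega>. g x) / real N" for g \<omega>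
    unfolding R_def by (rule emp_mean_comp_sum_list)

  \<comment> \<open>In this scale, total weight 1 means a rounded empirical mean of
    \<open>800 * e\<close>, and the expected supremum is at most 1/800, as
    \<open>fragment_cover\<close> demands.\<close>
  define l where "l j x = real (x ! j) / (800 * real N)" for j and x :: "nat list"
  have sum_l: "(\<Sum>x\<leftarrow>R \<omega>. l j x) = (\<Sum>i=1..N. real (nat \<lfloor>(fs ! j) (Y i \<omega>) / e\<rfloor>)) / (800 * real N)"
    if "j < length fs" for j \<omega>
    using that unfolding R_def l_def \<phi>_def
    by (simp add: sum.atLeast1_atMost_eq interv_sum_list_conv_sum_set_nat atLeast0LessThan comp_def sum_divide_distrib)
  have upper: "(\<Sum>x\<leftarrow>R \<omega>. l j x) \<le> emp_mean N Y (fs ! j) \<omega> / (800 * e)"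
    if j: "j < length fs" for j \<omega>
  proof -
    have "(\<Sum>i=1..N. real (nat \<lfloor>(fs ! j) (Y i \<omega>) / e\<rfloor>)) \<le> (\<Sum>i=1..N. (fs ! j) (Y i \<omega>) / e)"
      using j fs e(2) f_nonneg[of "fs ! j"] by (intro sum_mono) (auto simp: of_nat_nat)
    then have "(\<Sum>x\<leftarrow>R \<omega>. l j x) \<le> (\<Sum>i=1..N. (fs ! j) (Y i \<omega>) / e) / (800 * real N)"
      unfolding sum_l[OF j] by (intro divide_right_mono) auto
    also have "\<dots> = emp_mean N Y (fs ! j) \<omega> / (800 * e)"
      by (simp add: emp_mean_def flip: sum_divide_distrib)
    finally show ?thesis .
  qed
  have lower: "1 \<le> (\<Sum>x\<leftarrow>R \<omega>. l j x)" if j: "j < length fs" and big: "801 * e \<le> emp_mean N Y (fs ! j) \<omega>" for j \<omega>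
  proof -
    \<comment> \<open>Rounding loses at most one unit per point, which turns 801 into 800.\<close>
    have "(\<Sum>i=1..N. (fs ! j) (Y i \<omega>) / e - 1) \<le> (\<Sum>i=1..N. real (nat \<lfloor>(fs ! j) (Y i \<omega>) / e\<rfloor>))"
      by (intro sum_mono) linarith
    moreover have "800 * real N \<le> (\<Sum>i=1..N. (fs ! j) (Y i \<omega>) / e - 1)"
    proof -
      have "801 * e * real N \<le> (\<Sum>i=1..N. (fs ! j) (Y i \<omega>))"
        using big N by (simp add: emp_mean_def field_simps)
      then have "801 * real N \<le> (\<Sum>i=1..N. (fs ! j) (Y i \<omega>)) / e"
        using e(2) by (simp add: field_simps)
      then show ?thesis by (simp add: sum_subtractf sum_divide_distrib)
    qed
    ultimately show ?thesis unfolding sum_l[OF j] using N by simp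
  qed

  define \<Lambda> where "\<Lambda> = l ` {..<length fs}"
  have emp_sup_meas: "emp_sup N Y F \<in> borel_measurable M"
  proof -
    have "(\<lambda>\<omega>. f (Y i \<omega>)) \<in> borel_measurable M" if "f \<in> F" "i \<in> {1..N}" for f i
      using Y[OF that(2)] f_borel[OF that(1)] by (rule measurable_compose)
    then show ?thesis
      unfolding emp_sup_def emp_mean_def using \<open>finite F\<close>
      by (intro borel_measurable_SUP measurable_compose[OF _ measurable_ennreal]
            borel_measurable_times borel_measurable_sum borel_measurable_const)
         (auto intro: countable_finite)
  qed
  have "(\<integral>\<^sup>+y. (SUP l\<in>\<Lambda>. ennreal (\<Sum>x\<leftarrow>y. l x)) \<partial>replicate_pmf N p) =
        (\<integral>\<^sup>+\<omega>. (SUP l\<in>\<Lambda>. ennreal (\<Sum>x\<leftarrow>R \<omega>. l x)) \<partial>M)"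
    unfolding R_law[symmetric] using R by (subst nn_integral_distr) auto
  also have "\<dots> \<le> (\<integral>\<^sup>+\<omega>. ennreal (1 / (800 * e)) * emp_sup N Y F \<omega> \<partial>M)"
  proof (intro nn_integral_mono SUP_least)
    fix \<omega> k assume "k \<in> \<Lambda>"
    then obtain j where j: "j < length fs" "k = l j" by (auto simp: \<Lambda>_def)
    have "ennreal (\<Sum>x\<leftarrow>R \<omega>. k x) \<le> ennreal (1 / (800 * e) * emp_mean N Y (fs ! j) \<omega>)"
      using upper[OF j(1), of \<omega>] j(2) by (intro ennreal_leI) simp
    also have "\<dots> = ennreal (1 / (800 * e)) * ennreal (emp_mean N Y (fs ! j) \<omega>)"
      using e(2) by (intro ennreal_mult') simp
    also have "\<dots> \<le> ennreal (1 / (800 * e)) * emp_sup N Y F \<omega>"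
      unfolding emp_sup_def using j(1) fs by (intro mult_left_mono SUP_upper) auto
    finally show "ennreal (\<Sum>x\<leftarrow>R \<omega>. k x) \<le> ennreal (1 / (800 * e)) * emp_sup N Y F \<omega>" .
  qed
  also have "\<dots> = ennreal (1 / (800 * e)) * ennreal e"
    using emp_sup_meas by (simp add: nn_integral_cmult e(1)[unfolded expected_sup_def])
  also have "\<dots> = ennreal (1 / 800)" using e(2) by (simp flip: ennreal_mult)
  finally have mean: "(\<integral>\<^sup>+y. (SUP l\<in>\<Lambda>. ennreal (\<Sum>x\<leftarrow>y. l x)) \<partial>replicate_pmf N p) \<le> ennreal (1 / 800)" .
  obtain \<U> where \<U>: "\<And>U. U \<in> \<U> \<Longrightarrow> U \<noteq> {#} \<and> size U \<le> N"
    "\<And>l y. \<lbrakk>l \<in> \<Lambda>; length y = N; 1 \<le> (\<Sum>x\<leftarrow>y. l x)\<rbrakk> \<Longrightarrow> \<exists>U\<in>\<U>. U \<subseteq># mset y"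
    "(\<integral>\<^sup>+U. ennreal (cost N p U) \<partial>count_space \<U>) \<le> ennreal (1 / 2)"
    by (rule fragment_cover[OF _ mean]) (auto simp: \<Lambda>_def l_def)

  \<comment> \<open>The threshold is divided by \<open>N\<close> because \<open>emp_mean\<close>
    averages, while the tail bound concerns sums.\<close>
  define h where "h U = (tilt N p U \<circ> \<phi>, (\<Sum>x\<in>#U. tilt N p U x) / real N)" for U
  define null where "null = (indicat_real (- set_pmf p) \<circ> \<phi>, 1 / real N)"
  \<comment> \<open>Off the support \<open>tilt\<close> vanishes, so fragments leaving it are
    dropped; the samples containing them are caught by \<open>null\<close>.\<close>
  define \<U>' where "\<U>' = {U \<in> \<U>. set_mset U \<subseteq> set_pmf p}"
  define P where "P = (\<lambda>(g, t). emeasure M (half_space M N Y g t))"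
  have P_eq: "P (g \<circ> \<phi>, t / real N) = emeasure (replicate_pmf N p) {y. t \<le> (\<Sum>x\<leftarrow>y. g x)}" for g t
  proof -
    have "half_space M N Y (g \<circ> \<phi>) (t / real N) = R -` {y. t \<le> (\<Sum>x\<leftarrow>y. g x)} \<inter> space M"
      using N by (auto simp: half_space_def mean_g divide_le_cancel)
    then show ?thesis unfolding P_def R_law[symmetric] using R by (simp add: emeasure_distr)
  qed
  have P_null: "P null = 0"
  proof -
    have "P null = emeasure (replicate_pmf N p) {y. 1 \<le> (\<Sum>x\<leftarrow>y. indicat_real (- set_pmf p) x)}"
      unfolding null_def by (rule P_eq)
    also have "\<dots> = 0"
    proof -
      have "(\<Sum>x\<leftarrow>y. indicat_real (- set_pmf p) x) = 0" if "set y \<subseteq> set_pmf p" for y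
        using that by (induction y) auto
      then have "AE y in replicate_pmf N p. \<not> 1 \<le> (\<Sum>x\<leftarrow>y. indicat_real (- set_pmf p) x)"
        by (auto simp: AE_measure_pmf_iff set_replicate_pmf in_lists_conv_set subset_iff)
      from emeasure_eq_0_AE[OF this] show ?thesis by simp
    qed
    finally show ?thesis .
  qed
  have P_h: "P (h U) \<le> ennreal (cost N p U)" if "U \<in> \<U>'" for U
    using that \<U>(1)[of U] tilt_tail_le_cost[of U N p] by (auto simp: h_def P_eq \<U>'_def)
  \<comment> \<open>The index \<open>None\<close> stands for the null event that some sample point leaves the support of \<open>p\<close>.\<close>
  define C where "C = case_option null h ` insert None (Some ` \<U>')"
  have "small_cover 801 M N Y F C"
    unfolding small_cover_def
  proof (intro conjI)
    have "countable (UNIV :: nat list multiset set)"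
      using countable_image[of "UNIV :: nat list list set" mset] by (metis countableI_type surj_mset)
    then show "countable C" unfolding C_def
      by (intro countable_image countable_insert) (auto intro: countable_subset)
    have borel: "g \<circ> \<phi> \<in> nonneg_borel" if "\<And>x. 0 \<le> g x" for g :: "nat list \<Rightarrow> real"
      using that measurable_compose[OF \<phi>, of g borel] by (auto simp: nonneg_borel_def comp_def)
    show "C \<subseteq> nonneg_borel \<times> {0<..}"
      using N by (auto simp: C_def null_def h_def \<U>'_def tilt_nonneg dest: \<U>(1) intro!: borel divide_pos_pos tilt_sum_pos)
    show "{\<omega> \<in> space M. ennreal 801 * expected_sup M N Y F \<le> emp_sup N Y F \<omega>}
        \<subseteq> (\<Union>(g, t)\<in>C. half_space M N Y g t)"
    proof safe
      fix \<omega> assume \<omega>: "\<omega> \<in> space M" and big: "ennreal 801 * expected_sup M N Y F \<le> emp_sup N Y F \<omega>"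
      show "\<omega> \<in> (\<Union>(g, t)\<in>C. half_space M N Y g t)"
      proof (cases "set (R \<omega>) \<subseteq> set_pmf p")
        case True
        \<comment> \<open>An empty family would have expected supremum 0; for a nonempty finite one
          the supremum is attained.\<close>
        have "F \<noteq> {}" using pos by (auto simp: expected_sup_def emp_sup_def bot_ennreal)
        then have "emp_sup N Y F \<omega> \<in> (\<lambda>f. ennreal (emp_mean N Y f \<omega>)) ` F"
          unfolding emp_sup_def using \<open>finite F\<close> Max_in[of "(\<lambda>f. ennreal (emp_mean N Y f \<omega>)) ` F"]
          by (simp add: Max_Sup)
        then obtain f where f: "f \<in> F" "emp_sup N Y F \<omega> = ennreal (emp_mean N Y f \<omega>)" by blast
        then obtain j where j: "j < length fs" "f = fs ! j" using fs by (metis in_set_conv_nth)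
        have "0 \<le> emp_mean N Y f \<omega>"
          unfolding emp_mean_def using f_nonneg[OF f(1)] by (intro mult_nonneg_nonneg sum_nonneg) auto
        moreover have "ennreal (801 * e) \<le> ennreal (emp_mean N Y f \<omega>)"
          using big e unfolding f(2) e(1) by (simp add: ennreal_mult)
        ultimately have "801 * e \<le> emp_mean N Y f \<omega>" by simp
        then have "1 \<le> (\<Sum>x\<leftarrow>R \<omega>. l j x)" using lower j by simp
        then obtain U where U: "U \<in> \<U>" "U \<subseteq># mset (R \<omega>)"
          using \<U>(2)[of "l j" "R \<omega>"] j(1) len_R by (auto simp: \<Lambda>_def)
        have "set_mset U \<subseteq> set_pmf p" using set_mset_mono[OF U(2)] True by auto
        then have "U \<in> \<U>'" using U by (simp add: \<U>'_def)
        \<comment> \<open>A sample containing \<open>U\<close> lies in its half-space, since the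
          other points add only nonnegative amounts.\<close>
        have "(\<Sum>x\<in>#U. tilt N p U x) \<le> (\<Sum>x\<in>#mset (R \<omega>). tilt N p U x)"
        proof -
          obtain V where V: "mset (R \<omega>) = U + V" using U(2) by (metis subset_mset.le_iff_add)
          have "0 \<le> (\<Sum>x\<in>#V. tilt N p U x)" by (induction V) (auto simp: tilt_nonneg)
          then show ?thesis by (simp add: V)
        qed
        then have "\<omega> \<in> half_space M N Y (fst (h U)) (snd (h U))"
          using \<omega> N by (simp add: half_space_def h_def mean_g divide_right_mono flip: sum_mset_sum_list)
        moreover have "h U \<in> C" using \<open>U \<in> \<U>'\<close> by (force simp: C_def)
        ultimately show ?thesis by (auto simp: split_beta)
      next
        case False
        then obtain x where x: "x \<in> set (R \<omega>)" "x \<notin> set_pmf p" by blast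
        have "1 \<le> (\<Sum>x\<leftarrow>R \<omega>. indicat_real (- set_pmf p) x)"
        proof -
          have "indicat_real (- set_pmf p) x \<le> (\<Sum>x\<leftarrow>R \<omega>. indicat_real (- set_pmf p) x)"
            using x(1) by (intro member_le_sum_list) auto
          moreover have "indicat_real (- set_pmf p) x = 1" using x(2) by simp
          ultimately show ?thesis by linarith
        qed
        then have "\<omega> \<in> half_space M N Y (fst null) (snd null)"
          using \<omega> N by (simp add: half_space_def null_def mean_g divide_right_mono)
        moreover have "null \<in> C" by (force simp: C_def)
        ultimately show ?thesis by (auto simp: split_beta)
      qed
    qed
    have "infsum P C \<le> ennreal (1 / 2)"
      unfolding C_def
    proof (rule infsum_image_le)
      fix S assume S: "finite S" "S \<subseteq> insert None (Some ` \<U>')"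
      define T where "T = the ` (S - {None})"
      have T: "finite T" "T \<subseteq> \<U>'" using S by (auto simp: T_def)
      have "S \<subseteq> insert None (Some ` T)"
      proof
        fix x assume "x \<in> S"
        then show "x \<in> insert None (Some ` T)"
          by (cases x) (auto simp: T_def intro!: image_eqI[of _ the x])
      qed
      then have "(\<Sum>x\<in>S. P (case_option null h x)) \<le> (\<Sum>x\<in>insert None (Some ` T). P (case_option null h x))"
        using T by (intro sum_mono2) auto
      also have "\<dots> = (\<Sum>U\<in>T. P (h U))" using T by (simp add: P_null sum.reindex)
      also have "\<dots> \<le> (\<Sum>U\<in>T. ennreal (cost N p U))" using P_h T by (intro sum_mono) auto
      also have "\<dots> \<le> (\<integral>\<^sup>+U. ennreal (cost N p U) \<partial>count_space \<U>)"
        using T by (intro sum_le_nn_integral_count_space) (auto simp: \<U>'_def)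
      also note \<U>(3)
      finally show "(\<Sum>x\<in>S. P (case_option null h x)) \<le> ennreal (1 / 2)" .
    qed
    also have "ennreal (1 / 2) = 1 / 2"
      using divide_ennreal[of 1 2] by simp
    finally show "(\<Sum>\<^sub>\<infinity>(g, t)\<in>C. emeasure M (half_space M N Y g t)) \<le> 1 / 2"
      by (simp add: P_def)
  qed
  then show ?thesis by blast
qed

section \<open>Independence of the types\<close>

text \<open>A finite family sees a point of the Polish space only through the values of its members there,
  so a problem on any space is the pullback of one on sequences of reals.\<close>

lemma admissible_constant_transfer:
  assumes adm: "admissible_constant TYPE(nat \<Rightarrow> real) TYPE(nat \<Rightarrow> nat \<Rightarrow> real) L"
  shows "admissible_constant TYPE('a::polish_space) TYPE('w) L"
  unfolding admissible_constant_def
proof (intro allI impI)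
  fix N :: nat and \<nu> :: "'a measure" and M :: "'w measure" and Y :: "nat \<Rightarrow> 'w \<Rightarrow> 'a"
    and F :: "('a \<Rightarrow> real) set"
  assume N: "0 < N" and "prob_space \<nu>" and \<nu>_sets: "sets \<nu> = sets borel" and "prob_space M"
    and iid: "iid_sample M \<nu> N Y" and "finite F" and F: "F \<subseteq> nonneg_borel"
    and bdd: "\<forall>f\<in>F. bounded (range f)" and pos: "0 < expected_sup M N Y F" and fin: "expected_sup M N Y F < \<infinity>"
  interpret prob_space M by fact
  interpret \<nu>: prob_space \<nu> by fact
  obtain fs where fs: "set fs = F" using \<open>finite F\<close> finite_list by blast
  have f_nth: "fs ! j \<in> borel_measurable borel" "0 \<le> (fs ! j) x" "bounded (range (fs ! j))"
    if "j < length fs" for j x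
    using that F fs bdd nth_mem[OF that] by (auto simp: nonneg_borel_def)
  define \<phi> where "\<phi> x j = (if j < length fs then (fs ! j) x else 0)" for x j
  have \<phi>[measurable]: "\<phi> \<in> borel_measurable borel"
  proof (rule measurable_coordinatewise_then_product)
    fix j show "(\<lambda>x. \<phi> x j) \<in> borel_measurable borel"
      using f_nth(1)[of j] by (cases "j < length fs") (auto simp: \<phi>_def)
  qed
  have Y: "Y i \<in> measurable M borel" if "i \<in> {1..N}" for i
    using iid that by (auto simp: iid_sample_def indep_vars_def)
  have Y_law: "distr M borel (Y i) = \<nu>" if "i \<in> {1..N}" for i
    using iid that by (auto simp: iid_sample_def)
  \<comment> \<open>Only the \<open>Y i\<close> with \<open>i\<close> in \<open>{1..N}\<close> are
    known to be measurable, so the other coordinates are filled with a constant.\<close>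
  define \<Psi> where "\<Psi> \<omega> i = (if i \<in> {1..N} then \<phi> (Y i \<omega>) else (\<lambda>_. 0))" for \<omega> i
  have \<Psi>: "\<Psi> \<in> measurable M borel"
  proof (rule measurable_coordinatewise_then_product)
    fix i show "(\<lambda>\<omega>. \<Psi> \<omega> i) \<in> borel_measurable M"
      using measurable_compose[OF Y \<phi>, of i] by (cases "i \<in> {1..N}") (auto simp: \<Psi>_def)
  qed
  define M' where "M' = distr M borel \<Psi>"
  define \<nu>' where "\<nu>' = distr \<nu> borel \<phi>"
  define Y' where "Y' i w = w i" for i :: nat and w :: "nat \<Rightarrow> nat \<Rightarrow> real"
  have Y': "Y' i \<in> measurable M' borel" for i
    unfolding Y'_def M'_def by simp
  obtain b where b: "(fs ! j) x \<le> b j" if "j < length fs" for j x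
  proof -
    have "\<exists>B. \<forall>x. (fs ! j) x \<le> B" if "j < length fs" for j
      using f_nth(3)[OF that] by (auto simp: bounded_iff abs_le_iff)
    then show ?thesis using that by metis
  qed
  \<comment> \<open>Bare coordinates of sequences are unbounded and can be negative. Clipping them
    to lie between 0 and \<open>b j\<close> makes them admissible and changes nothing on the range
    of \<open>\<phi>\<close>.\<close>
  define k where "k j v = max 0 (min (v j) (b j))" for j :: nat and v :: "nat \<Rightarrow> real"
  define F' where "F' = k ` {..<length fs}"
  have k_\<phi>: "k j (\<phi> x) = (fs ! j) x" if "j < length fs" for j x
    using that b[OF that] f_nth(2)[OF that] by (simp add: k_def \<phi>_def)
  have k_borel: "k j \<in> borel_measurable borel" for j
    unfolding k_def by measurable
  have F': "finite F'" "F' \<subseteq> nonneg_borel" "\<forall>f\<in>F'. bounded (range f)"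
  proof -
    show "\<forall>f\<in>F'. bounded (range f)"
    proof
      fix f assume "f \<in> F'"
      then obtain j where "f = k j" by (auto simp: F'_def)
      then have "norm (f v) \<le> max 0 (b j)" for v by (auto simp: k_def)
      then show "bounded (range f)" by (intro boundedI[of _ "max 0 (b j)"]) auto
    qed
  qed (auto simp: F'_def nonneg_borel_def k_borel k_def[abs_def])
  have M': "prob_space M'" unfolding M'_def using \<Psi> by (rule prob_space_distr)
  have \<nu>': "prob_space \<nu>'" "sets \<nu>' = sets borel"
  proof -
    have "\<phi> \<in> measurable \<nu> borel" using \<phi> measurable_cong_sets[OF \<nu>_sets refl] by blast
    then show "prob_space \<nu>'" unfolding \<nu>'_def by (rule \<nu>.prob_space_distr)
  qed (simp add: \<nu>'_def)
  have \<Psi>_Y: "Y' i (\<Psi> \<omega>) = \<phi> (Y i \<omega>)" if "i \<in> {1..N}" for i \<omega>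
    using that by (simp add: Y'_def \<Psi>_def)
  have distr_Y': "distr M' borel (Y' i) = distr M borel (\<lambda>\<omega>. \<phi> (Y i \<omega>))" if i: "i \<in> {1..N}" for i
  proof -
    have "distr M' borel (Y' i) = distr M borel (Y' i \<circ> \<Psi>)"
      unfolding M'_def using Y'[unfolded M'_def] \<Psi> by (subst distr_distr) auto
    then show ?thesis using \<Psi>_Y[OF i] by (simp add: comp_def)
  qed
  have iid': "iid_sample M' \<nu>' N Y'"
    unfolding iid_sample_def
  proof (intro conjI ballI)
    show "prob_space.indep_vars M' (\<lambda>_. borel) Y' {1..N}"
    proof (subst prob_space.indep_vars_iff_distr_eq_PiM'[OF M'])
      \<comment> \<open>Independence is read off from the joint law: along \<open>\<Psi>\<close> it
        is that of the \<open>\<phi> (Y i \<omega>)\<close>, which is a product.\<close>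
      have "distr M' (\<Pi>\<^sub>M i\<in>{1..N}. borel) (\<lambda>w. \<lambda>i\<in>{1..N}. Y' i w) =
            distr M (\<Pi>\<^sub>M i\<in>{1..N}. borel) ((\<lambda>w. \<lambda>i\<in>{1..N}. Y' i w) \<circ> \<Psi>)"
        unfolding M'_def using Y'[unfolded M'_def] \<Psi>
        by (intro distr_distr measurable_restrict) auto
      also have "(\<lambda>w. \<lambda>i\<in>{1..N}. Y' i w) \<circ> \<Psi> = (\<lambda>\<omega>. \<lambda>i\<in>{1..N}. \<phi> (Y i \<omega>))"
        using \<Psi>_Y by (auto simp: fun_eq_iff)
      also have "distr M (\<Pi>\<^sub>M i\<in>{1..N}. borel) \<dots> = (\<Pi>\<^sub>M i\<in>{1..N}. distr M borel (\<lambda>\<omega>. \<phi> (Y i \<omega>)))"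
      proof (subst indep_vars_iff_distr_eq_PiM'[symmetric])
        show "indep_vars (\<lambda>_. borel) (\<lambda>i \<omega>. \<phi> (Y i \<omega>)) {1..N}"
          using iid by (auto simp: iid_sample_def intro!: indep_vars_compose2[where M' = "\<lambda>_. borel"])
      qed (use N measurable_compose[OF Y \<phi>] in auto)
      also have "\<dots> = (\<Pi>\<^sub>M i\<in>{1..N}. distr M' borel (Y' i))"
        by (intro PiM_cong) (simp_all add: distr_Y')
      finally show "distr M' (\<Pi>\<^sub>M i\<in>{1..N}. borel) (\<lambda>w. \<lambda>i\<in>{1..N}. Y' i w) =
          (\<Pi>\<^sub>M i\<in>{1..N}. distr M' borel (Y' i))" .
    qed (use N Y' in auto)
    fix i assume i: "i \<in> {1..N}"
    have "distr M borel (\<lambda>\<omega>. \<phi> (Y i \<omega>)) = distr (distr M borel (Y i)) borel \<phi>"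
      using distr_distr[OF \<phi> Y[OF i]] by (simp add: comp_def)
    then show "distr M' borel (Y' i) = \<nu>'" using Y_law[OF i] by (simp add: distr_Y'[OF i] \<nu>'_def)
  qed
  have mean_eq: "emp_mean N Y' g (\<Psi> \<omega>) = emp_mean N Y (g \<circ> \<phi>) \<omega>" for g \<omega>
    unfolding emp_mean_def using \<Psi>_Y by simp
  have sup_eq: "emp_sup N Y' F' (\<Psi> \<omega>) = emp_sup N Y F \<omega>" for \<omega>
  proof -
    have F_eq: "F = (\<lambda>j. fs ! j) ` {..<length fs}"
      unfolding fs[symmetric] by (auto simp: set_conv_nth)
    have k_eq: "emp_mean N Y' (k j) (\<Psi> \<omega>) = emp_mean N Y (fs ! j) \<omega>" if "j < length fs" for j
      unfolding mean_eq using k_\<phi>[OF that] by (simp add: comp_def)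
    have "emp_sup N Y' F' (\<Psi> \<omega>) = (SUP j\<in>{..<length fs}. ennreal (emp_mean N Y' (k j) (\<Psi> \<omega>)))"
      by (simp only: emp_sup_def F'_def image_image)
    also have "\<dots> = (SUP j\<in>{..<length fs}. ennreal (emp_mean N Y (fs ! j) \<omega>))"
      by (intro SUP_cong) (auto simp: k_eq)
    also have "\<dots> = emp_sup N Y F \<omega>"
      unfolding emp_sup_def by (subst F_eq) (simp only: image_image)
    finally show ?thesis .
  qed
  have mean_meas: "(\<lambda>w. emp_mean N Y' g w) \<in> borel_measurable borel" if "g \<in> borel_measurable borel" for g
    unfolding emp_mean_def Y'_def
    using measurable_compose[OF measurable_product_coordinates that]
    by (intro borel_measurable_times borel_measurable_const borel_measurable_sum) auto
  have expected_eq: "expected_sup M' N Y' F' = expected_sup M N Y F"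
  proof -
    have "emp_sup N Y' F' \<in> borel_measurable borel"
      unfolding emp_sup_def using F' mean_meas
      by (intro borel_measurable_SUP measurable_compose[OF _ measurable_ennreal])
         (auto simp: nonneg_borel_def intro: countable_finite)
    then show ?thesis unfolding expected_sup_def M'_def using \<Psi> by (simp add: nn_integral_distr sup_eq)
  qed
  obtain C' where C': "small_cover L M' N Y' F' C'"
    using adm[unfolded admissible_constant_def, rule_format, OF N \<nu>' M' iid' F'(1,2)] F'(3) pos fin
    unfolding expected_eq by blast
  \<comment> \<open>The cover is pulled back along \<open>\<phi>\<close>: the preimage under
    \<open>\<Psi>\<close> of a half-space of \<open>g\<close> is the half-space of
    \<open>g \<circ> \<phi>\<close>, with the same probability.\<close>
  define h where "h = (\<lambda>(g :: (nat \<Rightarrow> real) \<Rightarrow> real, t :: real). (g \<circ> \<phi>, t))"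
  define P where "P = (\<lambda>(g, t). emeasure M (half_space M N Y g t))"
  have P_h: "P (h (g, t)) = emeasure M' (half_space M' N Y' g t)" if "(g, t) \<in> C'" for g t
  proof -
    have g: "g \<in> borel_measurable borel"
      using C' that by (auto simp: small_cover_def nonneg_borel_def)
    have "{w. t \<le> emp_mean N Y' g w} \<in> sets borel"
      using measurable_sets[OF mean_meas[OF g], of "{t..}"] by (simp add: vimage_def)
    then have "emeasure M' (half_space M' N Y' g t) = emeasure M (\<Psi> -` {w. t \<le> emp_mean N Y' g w} \<inter> space M)"
      unfolding M'_def half_space_def using \<Psi> by (simp add: emeasure_distr)
    also have "\<Psi> -` {w. t \<le> emp_mean N Y' g w} \<inter> space M = half_space M N Y (g \<circ> \<phi>) t"
      by (auto simp: half_space_def mean_eq)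
    finally show ?thesis by (simp add: P_def h_def)
  qed
  have "small_cover L M N Y F (h ` C')"
    unfolding small_cover_def
  proof (intro conjI)
    show "countable (h ` C')" using C' by (simp add: small_cover_def)
    show "h ` C' \<subseteq> nonneg_borel \<times> {0<..}"
    proof
      fix c assume "c \<in> h ` C'"
      then obtain g t where gt: "(g, t) \<in> C'" "c = (g \<circ> \<phi>, t)" by (auto simp: h_def)
      then have "g \<in> nonneg_borel" "0 < t" using C' by (auto simp: small_cover_def)
      then show "c \<in> nonneg_borel \<times> {0<..}"
        using gt measurable_compose[OF \<phi>, of g borel] by (auto simp: nonneg_borel_def comp_def)
    qed
    show "{\<omega> \<in> space M. ennreal L * expected_sup M N Y F \<le> emp_sup N Y F \<omega>}
        \<subseteq> (\<Union>(g, t)\<in>h ` C'. half_space M N Y g t)"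
    proof
      fix \<omega> assume "\<omega> \<in> {\<omega> \<in> space M. ennreal L * expected_sup M N Y F \<le> emp_sup N Y F \<omega>}"
      then have \<omega>: "\<omega> \<in> space M" "ennreal L * expected_sup M' N Y' F' \<le> emp_sup N Y' F' (\<Psi> \<omega>)"
        by (auto simp: expected_eq sup_eq)
      have "\<Psi> \<omega> \<in> (\<Union>(g, t)\<in>C'. half_space M' N Y' g t)"
      proof (rule subsetD[rotated])
        show "{w \<in> space M'. ennreal L * expected_sup M' N Y' F' \<le> emp_sup N Y' F' w}
            \<subseteq> (\<Union>(g, t)\<in>C'. half_space M' N Y' g t)"
          using C' by (simp add: small_cover_def)
      qed (simp add: \<omega>(2), simp add: M'_def)
      then obtain g t where "(g, t) \<in> C'" "t \<le> emp_mean N Y' g (\<Psi> \<omega>)"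
        by (auto simp: half_space_def)
      then have "(g \<circ> \<phi>, t) \<in> h ` C'" "\<omega> \<in> half_space M N Y (g \<circ> \<phi>) t"
        using \<omega>(1) by (force simp: h_def, simp add: half_space_def mean_eq)
      then show "\<omega> \<in> (\<Union>(g, t)\<in>h ` C'. half_space M N Y g t)" by blast
    qed
    \<comment> \<open>Only an inequality, because \<open>h\<close> may merge pairs that differ off
      the range of \<open>\<phi>\<close>.\<close>
    have "infsum P (h ` C') \<le> (\<Sum>\<^sub>\<infinity>(g, t)\<in>C'. emeasure M' (half_space M' N Y' g t))"
    proof (rule infsum_image_le)
      fix S assume S: "finite S" "S \<subseteq> C'"
      have "(\<Sum>x\<in>S. P (h x)) = (\<Sum>(g, t)\<in>S. emeasure M' (half_space M' N Y' g t))"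
        using S P_h by (intro sum.cong) auto
      also have "\<dots> \<le> (\<Sum>\<^sub>\<infinity>(g, t)\<in>C'. emeasure M' (half_space M' N Y' g t))"
        using S by (subst nonneg_infsum_complete) (auto intro!: SUP_upper)
      finally show "(\<Sum>x\<in>S. P (h x)) \<le> (\<Sum>\<^sub>\<infinity>(g, t)\<in>C'. emeasure M' (half_space M' N Y' g t))" .
    qed
    also have "\<dots> \<le> 1 / 2" using C' by (simp add: small_cover_def)
    finally show "(\<Sum>\<^sub>\<infinity>(g, t)\<in>h ` C'. emeasure M (half_space M N Y g t)) \<le> 1 / 2"
      by (simp add: P_def)
  qed
  then show "\<exists>C. small_cover L M N Y F C" by blast
qed

theorem theorem1p3:
  "0 < universal_constant \<and>
   (\<forall>(N :: nat) (\<nu> :: 'a::polish_space measure) (M :: 'w measure)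
      (Y :: nat \<Rightarrow> 'w \<Rightarrow> 'a) (F :: ('a \<Rightarrow> real) set).
        0 < N \<longrightarrow>
        prob_space \<nu> \<longrightarrow> sets \<nu> = sets borel \<longrightarrow>
        prob_space M \<longrightarrow> iid_sample M \<nu> N Y \<longrightarrow>
        finite F \<longrightarrow> F \<subseteq> nonneg_borel \<longrightarrow> (\<forall>f\<in>F. bounded (range f)) \<longrightarrow>
        0 < expected_sup M N Y F \<longrightarrow> expected_sup M N Y F < \<infinity> \<longrightarrow>
        (\<exists>C. small_cover universal_constant M N Y F C))"
proof -
  \<comment> \<open>The value 801 only shows that the choice in \<open>universal_constant\<close> is
    not vacuous; the chosen number may be another one. What is known of it concerns one pair of
    types, and the transfer lemma carries this to all others.\<close>
  have "0 < (801 :: real) \<and> admissible_constant TYPE(nat \<Rightarrow> real) TYPE(nat \<Rightarrow> nat \<Rightarrow> real) 801"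
    unfolding admissible_constant_def using ex_small_cover by auto
  then have "0 < universal_constant \<and>
      admissible_constant TYPE(nat \<Rightarrow> real) TYPE(nat \<Rightarrow> nat \<Rightarrow> real) universal_constant"
    unfolding universal_constant_def by (rule someI)
  then show ?thesis
    using admissible_constant_transfer[of universal_constant, where ?'a = 'a and ?'w = 'w]
    unfolding admissible_constant_def by blast
qed

end
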